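(* There is an absolute constant $C>0$ such that for every $d\ge1$ and every $\epsilon\in(0,1/2]$ there exist an integer $k\le C\,\frac{1}{\epsilon^2}\log^2\frac1\epsilon$, a probability distribution over matrices $G\in\mathbb{R}^{d\times k}$, and a (possibly randomized) decision procedure $\mathcal{D}$ whose input is only the $k\times k$ matrix $G^TAG$, such that for every real symmetric $A\in\mathbb{R}^{d\times d}$: if $A$ is positive semidefinite then $\mathcal{D}(G^TAG)$ outputs True with probability at least $0.9$, and if $A\ne0$ and $\lambda_{\min}(A)\le-\epsilon\|A\|_F$ then $\mathcal{D}(G^TAG)$ outputs False with probability at least $0.9$. That is, the bilinear sketch $G^TAG$ of sketching dimension $k$ yields a two-sided $\ell_2$-tester that is correct with probability at least $0.9$.
   Context: $\|A\|_F$ is the Frobenius norm (Schatten-2 norm), and $\lambda_{\min}(A)$ the smallest eigenvalue. The distribution of $G$ may depend on $d$ and $\epsilon$ but not on $A$. *)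

theory Defs
  imports "HOL-Probability.Probability" "Jordan_Normal_Form.Spectral_Radius"
begin

text \<open>
  The Borel \<open>\<sigma>\<close>-algebra on the real \<open>m \<times> n\<close> matrices: the one generated by the entries.
\<close>

definition borel_mat :: "nat \<Rightarrow> nat \<Rightarrow> real mat measure" where
  "borel_mat m n =
     vimage_algebra (carrier_mat m n)
       (\<lambda>A. \<lambda>ij \<in> {..<m} \<times> {..<n}. A $$ ij)
       (\<Pi>\<^sub>M ij \<in> {..<m} \<times> {..<n}. borel)"

lemma space_borel_mat [simp]: "space (borel_mat m n) = carrier_mat m n"
  by (simp add: borel_mat_def)

definition symmetric_mat :: "real mat \<Rightarrow> bool" where
  "symmetric_mat A \<longleftrightarrow> transpose_mat A = A"

definition psd_mat :: "real mat \<Rightarrow> bool" where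
  "psd_mat A \<longleftrightarrow> symmetric_mat A \<and>
     (\<forall>x \<in> carrier_vec (dim_row A). scalar_prod x (A *\<^sub>v x) \<ge> 0)"

definition frobenius_norm :: "real mat \<Rightarrow> real" where
  "frobenius_norm A = sqrt (\<Sum>i<dim_row A. \<Sum>j<dim_col A. (A $$ (i, j))\<^sup>2)"

text \<open>
  Meaningful only when the real spectrum is finite and nonempty, as it is for a symmetric
  matrix of positive dimension.
\<close>

definition lambda_min :: "real mat \<Rightarrow> real" where
  "lambda_min A = Min (spectrum A)"

definition bilinear_sketch :: "real mat \<Rightarrow> real mat \<Rightarrow> real mat" where
  "bilinear_sketch A G = transpose_mat G * A * G"

text \<open>
  A randomized decision procedure on \<open>k \<times> k\<close> matrices is a Markov kernel from matrices to
  Booleans; its own coins are independent of the random matrix it is applied to.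
\<close>

definition decision_procedures :: "nat \<Rightarrow> (real mat \<Rightarrow> bool measure) set" where
  "decision_procedures k = borel_mat k k \<rightarrow>\<^sub>M prob_algebra (count_space UNIV)"

text \<open>
  The probability that \<open>D (G\<^sup>T A G)\<close> outputs \<open>b\<close> when \<open>G\<close> is drawn from \<open>M\<close>, over the joint
  randomness of \<open>G\<close> and \<open>D\<close>.
\<close>

definition prob_output ::
    "real mat measure \<Rightarrow> (real mat \<Rightarrow> bool measure) \<Rightarrow> real mat \<Rightarrow> bool \<Rightarrow> real" where
  "prob_output M D A b = measure (M \<bind> (\<lambda>G. D (bilinear_sketch A G))) {b}"

text \<open>
  The monadic bind above is junk for non-measurable arguments, so we check measurability.
\<close>

lemma measurable_entry [measurable]:
  assumes "i < m" "j < n"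
  shows "(\<lambda>A. A $$ (i, j)) \<in> borel_measurable (borel_mat m n)"
proof -
  have "(\<lambda>A. \<lambda>ij \<in> {..<m} \<times> {..<n}. A $$ ij)
      \<in> borel_mat m n \<rightarrow>\<^sub>M (\<Pi>\<^sub>M ij \<in> {..<m} \<times> {..<n}. (borel :: real measure))"
    unfolding borel_mat_def by (rule measurable_vimage_algebra1) (auto simp: space_PiM)
  from measurable_compose[OF this measurable_component_singleton[of "(i, j)"]]
  show ?thesis using assms by simp
qed

lemma measurable_into_borel_mat:
  assumes "\<And>x. x \<in> space N \<Longrightarrow> f x \<in> carrier_mat m n"
    and "\<And>i j. i < m \<Longrightarrow> j < n \<Longrightarrow> (\<lambda>x. f x $$ (i, j)) \<in> borel_measurable N"
  shows "f \<in> N \<rightarrow>\<^sub>M borel_mat m n"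
  unfolding borel_mat_def
proof (rule measurable_vimage_algebra2)
  show "f \<in> space N \<rightarrow> carrier_mat m n" using assms(1) by auto
  show "(\<lambda>x. \<lambda>ij \<in> {..<m} \<times> {..<n}. f x $$ ij)
      \<in> N \<rightarrow>\<^sub>M (\<Pi>\<^sub>M ij \<in> {..<m} \<times> {..<n}. (borel :: real measure))"
    using assms(2) by (intro measurable_restrict) auto
qed

lemma measurable_bilinear_sketch [measurable]:
  assumes A: "A \<in> carrier_mat d d"
  shows "bilinear_sketch A \<in> borel_mat d k \<rightarrow>\<^sub>M borel_mat k k"
proof (rule measurable_into_borel_mat)
  fix G :: "real mat" assume "G \<in> space (borel_mat d k)"
  then show "bilinear_sketch A G \<in> carrier_mat k k"
    using A by (auto simp: bilinear_sketch_def)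
next
  fix i j assume ij: "i < k" "j < k"
  let ?f = "\<lambda>G. \<Sum>p<d. G $$ (p, i) * (\<Sum>q<d. A $$ (p, q) * G $$ (q, j))"
  have f: "?f \<in> borel_measurable (borel_mat d k)"
    using ij by (intro borel_measurable_sum borel_measurable_times measurable_entry
      borel_measurable_const) auto
  have eq: "?f G = bilinear_sketch A G $$ (i, j)" if "G \<in> space (borel_mat d k)" for G
    using A ij that by (auto simp: bilinear_sketch_def scalar_prod_def lessThan_atLeast0)
  show "(\<lambda>G. bilinear_sketch A G $$ (i, j)) \<in> borel_measurable (borel_mat d k)"
    using f measurable_cong[of "borel_mat d k" ?f, OF eq] by simp
qed

lemma prob_output_eq_integral:
  assumes M: "prob_space M" "sets M = sets (borel_mat d k)"
    and D: "D \<in> decision_procedures k" and A: "A \<in> carrier_mat d d"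
  shows "prob_output M D A b = (\<integral>G. measure (D (bilinear_sketch A G)) {b} \<partial>M)"
proof -
  interpret prob_space M by (rule M(1))
  have D': "D \<in> borel_mat k k \<rightarrow>\<^sub>M subprob_algebra (count_space UNIV)"
    using D unfolding decision_procedures_def by (rule measurable_prob_algebraD)
  have "(\<lambda>G. D (bilinear_sketch A G)) \<in> borel_mat d k \<rightarrow>\<^sub>M subprob_algebra (count_space UNIV)"
    by (rule measurable_compose[OF measurable_bilinear_sketch[OF A] D'])
  then have "(\<lambda>G. D (bilinear_sketch A G)) \<in> M \<rightarrow>\<^sub>M subprob_algebra (count_space UNIV)"
    using M(2) by (simp cong: measurable_cong_sets)
  then show ?thesis
    unfolding prob_output_def by (rule measure_bind) simp
qed

end

theory Submission
  imports Defs
begin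

text \<open>
  The columns \<open>w a\<close> of the sketch are independent vectors of random signs, so the tester sees the numbers
  \<open>X a b = (w a)\<^sup>T A (w b)\<close>. For fixed \<open>y\<close>, the value \<open>\<Sum> y a y b X a b\<close> is a quadratic form
  in the signs with mean \<open>|y|\<^sup>2 tr A\<close>. If \<open>A\<close> is positive semidefinite, its lower tail is subgaussian with
  deviation \<open>|y|\<^sup>2 \<parallel>A\<parallel>\<^sub>F\<close>, so a union bound over a grid with at most \<open>(7 k)\<^sup>k\<close> points shows that
  \<open>X - (tr X / k) I\<close> has no grid direction with value below \<open>- c \<epsilon> k \<parallel>A\<parallel>\<^sub>F\<close> once
  \<open>\<epsilon>\<^sup>2 k\<close> is of order \<open>log k\<close>. If \<open>A u = \<mu> u\<close> with \<open>|u| = 1\<close> and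
  \<open>\<mu> \<le> - \<epsilon> \<parallel>A\<parallel>\<^sub>F\<close>, then \<open>y a = (w a)\<^sup>T u / sqrt k\<close> is such a direction, by second moment
  bounds: after subtracting \<open>\<mu> u u\<^sup>T\<close> the form is a sum of terms of conditional mean zero.
  The scale \<open>k \<parallel>A\<parallel>\<^sub>F\<close> is read off from the products of \<open>k\<close> columns with \<open>k\<close> further ones.
\<close>

section \<open>Averages over finite sets\<close>

text \<open>The union bound over the grid has to absorb a factor \<open>(7 k)^k\<close>, so a single
  direction may fail only with probability \<open>exp(- const k log k)\<close>. The two-sided tail
  of a quadratic form has a second regime governed by the operator norm of \<open>A\<close>; at a
  deviation of order \<open>\<epsilon> k |A|_F\<close> its exponent can drop to order
  \<open>\<epsilon> k\<close>, which loses against \<open>k log k\<close>. The lower tail of a psd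
  form is free of that regime, and acceptance needs only this tail: its exponent is of order
  \<open>\<epsilon>^2 k^2\<close>. Rejection needs one good direction instead of all of them, so
  second moments suffice there, although the direction is built from the very columns on which it is
  tested. Signs in place of Gaussians keep the probability space finite: every expectation is a
  finite average, and moment bounds are inductions that average over one sign or one column at a
  time. The scale is read off from products of distinct columns because these have mean zero
  whatever \<open>tr A\<close> is, while a diagonal entry has mean \<open>tr A\<close>.\<close>

definition avg :: "'a set \<Rightarrow> ('a \<Rightarrow> real) \<Rightarrow> real" where
  "avg S f = (\<Sum>x\<in>S. f x) / real (card S)"

lemma avg_cong: "(\<And>x. x \<in> S \<Longrightarrow> f x = g x) \<Longrightarrow> avg S f = avg S g"
  by (simp add: avg_def cong: sum.cong)

lemma avg_add: "avg S (\<lambda>x. f x + g x) = avg S f + avg S g"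
  by (simp add: avg_def sum.distrib add_divide_distrib)

lemma avg_diff: "avg S (\<lambda>x. f x - g x) = avg S f - avg S g"
  by (simp add: avg_def sum_subtractf diff_divide_distrib)

lemma avg_cmult: "avg S (\<lambda>x. c * f x) = c * avg S f"
  by (simp add: avg_def sum_distrib_left[symmetric])

lemma avg_divide: "avg S (\<lambda>x. f x / c) = avg S f / c"
  by (simp add: avg_def sum_divide_distrib[symmetric])

lemma avg_sum: "avg S (\<lambda>x. \<Sum>i\<in>I. f i x) = (\<Sum>i\<in>I. avg S (f i))"
  unfolding avg_def by (subst sum.swap) (simp add: sum_divide_distrib)

text \<open>Linearity and monotonicity hold for every set because division by zero makes the average
  over an empty or infinite set 0; constants are where that default shows.\<close>

lemma avg_const: "finite S \<Longrightarrow> S \<noteq> {} \<Longrightarrow> avg S (\<lambda>x. c) = c"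
  by (simp add: avg_def)

lemma avg_mono: "(\<And>x. x \<in> S \<Longrightarrow> f x \<le> g x) \<Longrightarrow> avg S f \<le> avg S g"
  by (simp add: avg_def sum_mono divide_right_mono)

lemma avg_pm_one: "avg {-1, 1::real} f = (f (-1) + f 1) / 2"
  by (simp add: avg_def)

text \<open>Finite Fubini for one coordinate: \<open>a\<close> is averaged first while the others
  are frozen. Inductions over signs and over columns both rest on this step.\<close>

lemma avg_PiE_insert:
  assumes "finite J" "a \<notin> J" "finite V"
  shows "avg (PiE (insert a J) (\<lambda>_. V)) f =
    avg (PiE J (\<lambda>_. V)) (\<lambda>w. avg V (\<lambda>g. f (w(a := g))))"
proof -
  have "(\<Sum>x\<in>PiE (insert a J) (\<lambda>_. V). f x) = (\<Sum>(g, w)\<in>V \<times> PiE J (\<lambda>_. V). f (w(a := g)))"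
    unfolding PiE_insert_eq
    by (subst sum.reindex) (use inj_combinator[OF assms(2), of "\<lambda>_. V"] in
      \<open>auto simp: case_prod_unfold\<close>)
  also have "\<dots> = (\<Sum>w\<in>PiE J (\<lambda>_. V). \<Sum>g\<in>V. f (w(a := g)))"
    by (subst sum.swap) (simp add: sum.cartesian_product)
  finally show ?thesis
    using assms by (simp add: avg_def card_PiE sum_divide_distrib[symmetric] mult.commute)
qed

lemma finite_PiE_const: "finite J \<Longrightarrow> finite V \<Longrightarrow> finite (PiE J (\<lambda>_. V))"
  by (simp add: finite_PiE)

text \<open>Independence of two blocks of coordinates; \<open>override_on w v H\<close> glues the
  halves together, so that one block can be frozen while the other is averaged.\<close>

lemma avg_PiE_Un:
  assumes "finite J" "finite H" "J \<inter> H = {}" "finite V" "V \<noteq> {}"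
  shows "avg (PiE (J \<union> H) (\<lambda>_. V)) f =
    avg (PiE J (\<lambda>_. V)) (\<lambda>w. avg (PiE H (\<lambda>_. V)) (\<lambda>v. f (override_on w v H)))"
  using assms(2,3)
proof (induction H arbitrary: f)
  case empty
  then show ?case by (simp add: avg_def)
next
  case (insert h H)
  have "avg (PiE (J \<union> insert h H) (\<lambda>_. V)) f =
      avg (PiE (J \<union> H) (\<lambda>_. V)) (\<lambda>w. avg V (\<lambda>g. f (w(h := g))))"
    using avg_PiE_insert[of "J \<union> H" h V f] insert assms by simp
  also have "\<dots> = avg (PiE J (\<lambda>_. V)) (\<lambda>w. avg (PiE H (\<lambda>_. V))
      (\<lambda>v. avg V (\<lambda>g. f ((override_on w v H)(h := g)))))"
    using insert by (subst insert.IH) auto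
  also have "\<dots> = avg (PiE J (\<lambda>_. V)) (\<lambda>w. avg (PiE (insert h H) (\<lambda>_. V))
      (\<lambda>v. f (override_on w v (insert h H))))"
    using insert.hyps assms
    by (subst avg_PiE_insert) (auto simp: override_on_def intro!: avg_cong arg_cong[of _ _ f])
  finally show ?case .
qed

lemma avg_PiE_restrict:
  assumes "finite J" "finite H" "J \<inter> H = {}" "finite V" "V \<noteq> {}"
    and "\<And>w v. f (override_on w v H) = f w"
  shows "avg (PiE (J \<union> H) (\<lambda>_. V)) f = avg (PiE J (\<lambda>_. V)) f"
  using assms by (simp add: avg_PiE_Un avg_const finite_PiE_const PiE_eq_empty_iff)

text \<open>Markov's inequality with the union bound built in: \<open>Z\<close> is meant to be a sum
  of nonnegative quantities, each scaled so that a value below 1 rules out one failure. Then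
  \<open>Z x < 1\<close> rules out all of them at once.\<close>

lemma avg_of_bool_ge:
  assumes "finite S" "S \<noteq> {}" "avg S Z \<le> p"
    and "\<And>x. x \<in> S \<Longrightarrow> 0 \<le> Z x" "\<And>x. x \<in> S \<Longrightarrow> Z x < 1 \<Longrightarrow> P x"
  shows "avg S (\<lambda>x. of_bool (P x)) \<ge> 1 - p"
proof -
  have "avg S (\<lambda>x. 1 - Z x) \<le> avg S (\<lambda>x. of_bool (P x))"
    using assms(4,5) by (intro avg_mono) (force simp: not_less)
  then show ?thesis
    using assms(1-3) by (simp add: avg_diff avg_const)
qed

section \<open>Quadratic forms in random signs\<close>

text \<open>Vectors and matrices are functions read only on \<open>I\<close>. This permits induction
  on the index set and product index sets such as \<open>J \<times> I\<close>; matrices of fixed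
  dimension enter only at the end.\<close>

definition ip :: "'i set \<Rightarrow> ('i \<Rightarrow> real) \<Rightarrow> ('i \<Rightarrow> real) \<Rightarrow> real" where
  "ip I x y = (\<Sum>i\<in>I. x i * y i)"

definition mv :: "'i set \<Rightarrow> ('i \<Rightarrow> 'i \<Rightarrow> real) \<Rightarrow> ('i \<Rightarrow> real) \<Rightarrow> 'i \<Rightarrow> real" where
  "mv I M x = (\<lambda>i. \<Sum>j\<in>I. M i j * x j)"

definition bf :: "'i set \<Rightarrow> ('i \<Rightarrow> 'i \<Rightarrow> real) \<Rightarrow> ('i \<Rightarrow> real) \<Rightarrow> ('i \<Rightarrow> real) \<Rightarrow> real" where
  "bf I M x y = (\<Sum>i\<in>I. \<Sum>j\<in>I. M i j * x i * y j)"

definition tr :: "'i set \<Rightarrow> ('i \<Rightarrow> 'i \<Rightarrow> real) \<Rightarrow> real" where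
  "tr I M = (\<Sum>i\<in>I. M i i)"

definition frob2 :: "'i set \<Rightarrow> ('i \<Rightarrow> 'i \<Rightarrow> real) \<Rightarrow> real" where
  "frob2 I M = (\<Sum>i\<in>I. \<Sum>j\<in>I. (M i j)\<^sup>2)"

definition symmetric_on :: "'i set \<Rightarrow> ('i \<Rightarrow> 'i \<Rightarrow> real) \<Rightarrow> bool" where
  "symmetric_on I M \<longleftrightarrow> (\<forall>i\<in>I. \<forall>j\<in>I. M i j = M j i)"

definition psd_on :: "'i set \<Rightarrow> ('i \<Rightarrow> 'i \<Rightarrow> real) \<Rightarrow> bool" where
  "psd_on I M \<longleftrightarrow> symmetric_on I M \<and> (\<forall>x. 0 \<le> bf I M x x)"

definition signs :: "'i set \<Rightarrow> ('i \<Rightarrow> real) set" where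
  "signs I = PiE I (\<lambda>_. {-1, 1})"

lemma finite_signs [simp]: "finite I \<Longrightarrow> finite (signs I)"
  by (simp add: signs_def finite_PiE)

lemma signs_nonempty [simp]: "signs I \<noteq> {}"
  by (simp add: signs_def PiE_eq_empty_iff)

lemma avg_signs_insert:
  "finite I \<Longrightarrow> a \<notin> I \<Longrightarrow> avg (signs (insert a I)) f =
    avg (signs I) (\<lambda>x. (f (x(a := -1)) + f (x(a := 1))) / 2)"
  by (simp add: signs_def avg_PiE_insert avg_pm_one)

lemma bf_insert_upd:
  assumes "finite I" "a \<notin> I"
  shows "bf (insert a I) M (x(a := s)) (x(a := s)) =
    M a a * s\<^sup>2 + s * (ip I (M a) x + ip I (\<lambda>j. M j a) x) + bf I M x x"
proof -
  have 1: "(\<Sum>j\<in>I. M a j * s * (x(a := s)) j) = s * ip I (M a) x"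
    unfolding ip_def sum_distrib_left using assms by (intro sum.cong) auto
  have 2: "(\<Sum>i\<in>I. M i a * (x(a := s)) i * s) = s * ip I (\<lambda>j. M j a) x"
    unfolding ip_def sum_distrib_left using assms by (intro sum.cong) auto
  have 3: "(\<Sum>i\<in>I. \<Sum>j\<in>I. M i j * (x(a := s)) i * (x(a := s)) j) = bf I M x x"
    unfolding bf_def using assms by (intro sum.cong) auto
  show ?thesis
    using assms 1 2 3
    by (simp add: bf_def[of "insert a I"] sum.distrib power2_eq_square algebra_simps)
qed

lemma symmetric_onD: "symmetric_on I M \<Longrightarrow> i \<in> I \<Longrightarrow> j \<in> I \<Longrightarrow> M i j = M j i"
  unfolding symmetric_on_def by blast

lemma frob2_insert:
  assumes "finite I" "a \<notin> I" "symmetric_on (insert a I) M"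
  shows "frob2 (insert a I) M = (M a a)\<^sup>2 + 2 * (\<Sum>j\<in>I. (M a j)\<^sup>2) + frob2 I M"
proof -
  have "(\<Sum>i\<in>I. (M i a)\<^sup>2) = (\<Sum>j\<in>I. (M a j)\<^sup>2)"
    by (rule sum.cong[OF refl]) (subst symmetric_onD[OF assms(3), of _ a], auto)
  then show ?thesis
    using assms by (simp add: frob2_def sum.distrib)
qed

lemma frob2_nonneg: "0 \<le> frob2 I M"
  by (simp add: frob2_def sum_nonneg)

lemma symmetric_on_subset: "symmetric_on J M \<Longrightarrow> I \<subseteq> J \<Longrightarrow> symmetric_on I M"
  unfolding symmetric_on_def by blast

lemma avg_signs_bf:
  assumes "finite I"
  shows "avg (signs I) (\<lambda>x. bf I M x x) = tr I M"
  using assms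
proof (induction I)
  case empty
  then show ?case by (simp add: bf_def tr_def avg_def)
next
  case (insert a I)
  have "avg (signs (insert a I)) (\<lambda>x. bf (insert a I) M x x) =
      avg (signs I) (\<lambda>x. M a a + bf I M x x)"
    using insert by (simp add: avg_signs_insert bf_insert_upd add_divide_distrib)
  then show ?case
    using insert by (simp add: avg_add avg_const tr_def)
qed

lemma bf_outer: "bf I (\<lambda>i j. u i * v j) x y = ip I x u * ip I y v"
  by (simp add: bf_def ip_def sum_product algebra_simps)

lemma avg_signs_ip_ip:
  "finite I \<Longrightarrow> avg (signs I) (\<lambda>x. ip I x u * ip I x v) = ip I u v"
  using avg_signs_bf[of I "\<lambda>i j. u i * v j"] by (simp add: bf_outer tr_def ip_def)

lemma ip_commute: "ip I x y = ip I y x"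
  by (simp add: ip_def mult.commute)

text \<open>Since squares of signs are 1, the diagonal contributes no variance. Revealing the sign
  at \<open>a\<close> adds \<open>4 * (ip I x (M a))\<^sup>2\<close>, whose average is exactly twice
  what the off-diagonal entries of row and column \<open>a\<close> add to
  \<open>frob2\<close>.\<close>

lemma avg_signs_var:
  assumes "finite I" "symmetric_on I M"
  shows "avg (signs I) (\<lambda>x. (bf I M x x - tr I M)\<^sup>2) \<le> 2 * frob2 I M"
  using assms
proof (induction I)
  case empty
  then show ?case by (simp add: bf_def tr_def avg_def frob2_def)
next
  case (insert a I)
  have sym: "ip I (\<lambda>j. M j a) x = ip I (M a) x" for x
    unfolding ip_def by (rule sum.cong[OF refl]) (subst symmetric_onD[OF insert.prems, of _ a], auto simp: mult.commute)
  have ring: "((\<alpha> * (-1)\<^sup>2 + (-1) * (\<beta> + \<beta>) + Q - (\<alpha> + T))\<^sup>2 +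
      (\<alpha> * 1\<^sup>2 + 1 * (\<beta> + \<beta>) + Q - (\<alpha> + T))\<^sup>2) / 2 = 4 * (\<beta> * \<beta>) + (Q - T)\<^sup>2"
    for \<alpha> \<beta> Q T :: real
  proof -
    have "(2 * \<beta> + R)\<^sup>2 + (R - 2 * \<beta>)\<^sup>2 = 2 * (4 * (\<beta> * \<beta>) + R\<^sup>2)" for R
      by (simp add: power2_eq_square algebra_simps)
    from this[of "Q - T"] show ?thesis by (simp add: algebra_simps)
  qed
  have "avg (signs (insert a I)) (\<lambda>x. (bf (insert a I) M x x - tr (insert a I) M)\<^sup>2) =
      avg (signs I) (\<lambda>x. 4 * (ip I x (M a) * ip I x (M a)) + (bf I M x x - tr I M)\<^sup>2)"
    unfolding avg_signs_insert[OF insert.hyps]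
  proof (rule avg_cong)
    fix x
    have t: "tr (insert a I) M = M a a + tr I M" using insert by (simp add: tr_def)
    show "((bf (insert a I) M (x(a := - 1)) (x(a := - 1)) - tr (insert a I) M)\<^sup>2 +
          (bf (insert a I) M (x(a := 1)) (x(a := 1)) - tr (insert a I) M)\<^sup>2) / 2 =
         4 * (ip I x (M a) * ip I x (M a)) + (bf I M x x - tr I M)\<^sup>2"
      unfolding bf_insert_upd[OF insert.hyps] sym t ip_commute[of I "M a" x]
      by (rule ring)
  qed
  also have "\<dots> = 4 * ip I (M a) (M a) + avg (signs I) (\<lambda>x. (bf I M x x - tr I M)\<^sup>2)"
    using insert by (simp add: avg_add avg_cmult avg_signs_ip_ip)
  also have "\<dots> \<le> 4 * ip I (M a) (M a) + 2 * frob2 I M"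
    using insert.IH[OF symmetric_on_subset[OF insert.prems]] by auto
  also have "\<dots> \<le> 2 * frob2 (insert a I) M"
    unfolding frob2_insert[OF insert.hyps insert.prems] by (simp add: ip_def power2_eq_square)
  finally show ?case .
qed

lemma ip_self_nonneg: "0 \<le> ip I x x"
  by (simp add: ip_def sum_nonneg)

lemma ip_Cauchy_Schwarz: "(ip I x y)\<^sup>2 \<le> ip I x x * ip I y y"
  unfolding ip_def using Cauchy_Schwarz_ineq_sum[of x y I] by (simp add: power2_eq_square)

text \<open>A product of two linear forms is the quadratic form of the symmetrized outer product, so
  the variance bound applies: 3 is 2 from the variance plus 1 from the squared mean.\<close>

lemma avg_signs_fourth:
  assumes "finite I"
  shows "avg (signs I) (\<lambda>x. (ip I x u * ip I x v)\<^sup>2) \<le> 3 * ip I u u * ip I v v"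
proof -
  define M where "M = (\<lambda>i j. (u i * v j + v i * u j) / 2)"
  have bf: "bf I M x x = ip I x u * ip I x v" for x
  proof -
    have "bf I M x x = (bf I (\<lambda>i j. u i * v j) x x + bf I (\<lambda>i j. v i * u j) x x) / 2"
      unfolding bf_def M_def sum.distrib[symmetric] sum_divide_distrib
      by (intro sum.cong refl) (simp add: algebra_simps)
    then show ?thesis by (simp add: bf_outer)
  qed
  have tr: "tr I M = ip I u v"
    by (simp add: tr_def M_def ip_def mult.commute)
  have "frob2 I M \<le> (\<Sum>i\<in>I. \<Sum>j\<in>I. ((u i * u i) * (v j * v j) + (v i * v i) * (u j * u j)) / 2)"
    unfolding frob2_def M_def
  proof (intro sum_mono)
    fix i j
    have "0 \<le> (u i * v j - v i * u j)\<^sup>2" by simp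
    then show "((u i * v j + v i * u j) / 2)\<^sup>2 \<le> ((u i * u i) * (v j * v j) + (v i * v i) * (u j * u j)) / 2"
      by (simp add: power2_eq_square field_simps)
  qed
  also have "\<dots> = (ip I u u * ip I v v + ip I v v * ip I u u) / 2"
    unfolding ip_def sum_product sum.distrib[symmetric] sum_divide_distrib ..
  finally have fr: "frob2 I M \<le> ip I u u * ip I v v" by simp
  have "(bf I M x x - tr I M)\<^sup>2 =
      (ip I x u * ip I x v)\<^sup>2 - (2 * ip I u v) * (ip I x u * ip I x v) + (ip I u v)\<^sup>2" for x
    unfolding bf tr by (simp only: power2_diff) (simp add: mult.commute)
  then have "avg (signs I) (\<lambda>x. (bf I M x x - tr I M)\<^sup>2) =
      avg (signs I) (\<lambda>x. (ip I x u * ip I x v)\<^sup>2) - 2 * ip I u v * ip I u v + (ip I u v)\<^sup>2"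
    using assms by (simp only: avg_add avg_diff avg_cmult avg_signs_ip_ip avg_const
      finite_signs signs_nonempty not_False_eq_True)
  moreover have "symmetric_on I M"
    by (simp add: symmetric_on_def M_def add.commute mult.commute)
  then have "avg (signs I) (\<lambda>x. (bf I M x x - tr I M)\<^sup>2) \<le> 2 * frob2 I M"
    by (rule avg_signs_var[OF assms])
  ultimately show ?thesis
    using fr ip_Cauchy_Schwarz[of I u v] by (simp add: power2_eq_square)
qed

section \<open>The lower tail of positive semidefinite forms\<close>

text \<open>Termwise comparison of power series: the even terms of cosh have denominators
  \<open>fact (2 * n)\<close>, which dominate \<open>2 ^ n * fact n\<close>.\<close>

lemma cosh_le_exp: "(exp z + exp (- z)) / 2 \<le> exp (z\<^sup>2 / 2)" for z :: real
proof -
  define f where "f = (\<lambda>n. if even n then z ^ n /\<^sub>R fact n else 0)"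
  have "f sums cosh z"
    unfolding f_def by (rule cosh_converges)
  moreover have "f n = 0" if "n \<notin> range (\<lambda>n::nat. 2 * n)" for n
  proof -
    have "\<not> 2 dvd n" using that unfolding dvd_def by blast
    then show ?thesis by (simp add: f_def)
  qed
  ultimately have s1: "(\<lambda>n. f (2 * n)) sums cosh z"
    using sums_mono_reindex[of "\<lambda>n::nat. 2 * n" f "cosh z"] by (simp add: strict_mono_def)
  have s2: "(\<lambda>n. (z\<^sup>2 / 2) ^ n /\<^sub>R fact n) sums exp (z\<^sup>2 / 2)"
    by (rule exp_converges)
  have "f (2 * n) \<le> (z\<^sup>2 / 2) ^ n /\<^sub>R fact n" for n
  proof -
    have fact: "2 ^ n * fact n \<le> (fact (2 * n) :: real)"
    proof (induction n)
      case (Suc n)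
      have "2 ^ Suc n * fact (Suc n) = (2 * real n + 2) * (2 ^ n * fact n)"
        unfolding fact_Suc of_nat_Suc power_Suc by (simp only: distrib_left distrib_right mult_ac mult_1_right)
      also have "\<dots> \<le> (2 * real n + 2) * ((2 * real n + 1) * fact (2 * n))"
      proof (intro mult_left_mono)
        have "1 * fact (2 * n) \<le> (2 * real n + 1) * fact (2 * n)"
          by (intro mult_right_mono) auto
        then show "2 ^ n * fact n \<le> (2 * real n + 1) * fact (2 * n)" using Suc.IH by linarith
      qed simp
      also have "\<dots> = fact (Suc (Suc (2 * n)))"
        unfolding fact_Suc of_nat_Suc of_nat_mult by (simp only: of_nat_numeral mult_ac add_ac) simp
      finally show ?case by (simp only: mult_Suc_right add_2_eq_Suc)
    qed simp
    have "z ^ (2 * n) / fact (2 * n) \<le> z ^ (2 * n) / (2 ^ n * fact n)"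
      by (intro divide_left_mono fact) auto
    also have "\<dots> = (z\<^sup>2 / 2) ^ n / fact n"
      unfolding power_mult power_divide by simp
    finally show ?thesis
      by (simp only: f_def dvd_triv_left if_True real_scaleR_def divide_inverse mult.commute[of "inverse _"])
  qed
  then have "cosh z \<le> exp (z\<^sup>2 / 2)"
    using sums_le[OF _ s1 s2] by blast
  then show ?thesis unfolding cosh_field_def .
qed

lemma bf_minus_outer:
  "bf I (\<lambda>i j. M i j - c * b i * b j) x y = bf I M x y - c * ip I b x * ip I b y"
proof -
  have "c * ip I b x * ip I b y = (\<Sum>i\<in>I. \<Sum>j\<in>I. c * b i * b j * x i * y j)"
    unfolding ip_def mult.assoc[of c] sum_product unfolding sum_distrib_left
    by (intro sum.cong refl) (simp only: mult_ac)
  then show ?thesis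
    by (simp add: bf_def sum_subtractf[symmetric] algebra_simps)
qed

lemma frob2_minus_outer:
  "frob2 I M = frob2 I (\<lambda>i j. M i j - c * b i * b j) +
    2 * c * bf I (\<lambda>i j. M i j - c * b i * b j) b b + c\<^sup>2 * (ip I b b)\<^sup>2"
proof -
  let ?N = "\<lambda>i j. M i j - c * b i * b j"
  have "(M i j)\<^sup>2 = (?N i j)\<^sup>2 + (2 * c) * (?N i j * b i * b j) + c\<^sup>2 * ((b i * b i) * (b j * b j))" for i j
    by (simp add: power2_eq_square algebra_simps)
  then show ?thesis
    by (simp only: frob2_def bf_def sum.distrib sum_distrib_left[symmetric] ip_def
      power2_eq_square[of "sum _ _"] sum_product)
qed

text \<open>Writing \<open>M = N + c b b^T\<close>, the cross term of the squared Frobenius norm is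
  \<open>2 c b^T N b\<close>, nonnegative because the remainder \<open>N\<close> is psd.\<close>

lemma frob2_minus_outer_le:
  assumes "psd_on I (\<lambda>i j. M i j - c * b i * b j)" "c \<ge> 0"
  shows "frob2 I (\<lambda>i j. M i j - c * b i * b j) \<le> frob2 I M"
  using assms frob2_minus_outer[of I M c b] by (simp add: psd_on_def)

text \<open>The free \<open>s\<close> is chosen later: a suitable multiple of
  \<open>ip I (M a) x\<close> turns this inequality into positivity of \<open>M - c b b^T\<close>,
  with \<open>b\<close> the row of \<open>a\<close>.\<close>

lemma psd_on_insert:
  assumes "finite I" "a \<notin> I" "psd_on (insert a I) M"
  shows "0 \<le> M a a * s\<^sup>2 + 2 * s * ip I (M a) x + bf I M x x"
proof -
  have "ip I (\<lambda>j. M j a) x = ip I (M a) x"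
    unfolding ip_def
    by (rule sum.cong[OF refl], subst symmetric_onD[of "insert a I" M _ a])
      (use assms(3) in \<open>auto simp: psd_on_def\<close>)
  moreover have "0 \<le> bf (insert a I) M (x(a := s)) (x(a := s))"
    using assms(3) unfolding psd_on_def by blast
  ultimately show ?thesis
    using bf_insert_upd[OF assms(1,2), of M x s] by (simp add: algebra_simps)
qed

text \<open>The lower tail of a positive semidefinite form is subgaussian, with no contribution from the
  operator norm. Averaging over the sign \<open>x a\<close> leaves the form of \<open>M - c b b\<^sup>T\<close>, where \<open>b\<close> is the
  row of \<open>a\<close>, which is again positive semidefinite and has smaller Frobenius norm: one takes
  \<open>c = 2 t\<close> while the diagonal entry is at most \<open>1 / (2 t)\<close>, and otherwise the Schur complement
  \<open>c = 1 / M a a\<close>.\<close>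

lemma avg_signs_exp_psd:
  assumes "finite I" "psd_on I M" "0 \<le> t"
  shows "avg (signs I) (\<lambda>x. exp (- t * bf I M x x)) \<le> exp (- t * tr I M + 2 * t\<^sup>2 * frob2 I M)"
  using assms(1,2)
proof (induction I arbitrary: M)
  case empty
  then show ?case by (simp add: bf_def tr_def frob2_def avg_def)
next
  case (insert a I)
  define \<alpha> where "\<alpha> = M a a"
  define b where "b = M a"
  define \<beta> where "\<beta> = ip I b b"
  have sym: "symmetric_on (insert a I) M" using insert.prems by (simp add: psd_on_def)
  have q: "0 \<le> \<alpha> * s\<^sup>2 + 2 * s * ip I b x + bf I M x x" for s x
    unfolding \<alpha>_def b_def by (rule psd_on_insert[OF insert.hyps insert.prems])
  have \<alpha>: "0 \<le> \<alpha>"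
    using q[of 1 "\<lambda>_. 0"] by (simp add: bf_def ip_def)
  have \<beta>: "0 \<le> \<beta>" by (simp add: \<beta>_def ip_self_nonneg)
  have bf: "bf (insert a I) M (x(a := s)) (x(a := s)) = \<alpha> * s\<^sup>2 + 2 * s * ip I b x + bf I M x x" for x s
  proof -
    have "ip I (\<lambda>j. M j a) x = ip I (M a) x"
      unfolding ip_def
      by (rule sum.cong[OF refl]) (subst symmetric_onD[OF sym, of _ a], auto)
    then show ?thesis
      using bf_insert_upd[OF insert.hyps, of M x s] by (simp add: \<alpha>_def b_def algebra_simps)
  qed
  have frob: "frob2 (insert a I) M = \<alpha>\<^sup>2 + 2 * \<beta> + frob2 I M"
    unfolding frob2_insert[OF insert.hyps sym] \<alpha>_def \<beta>_def b_def ip_def power2_eq_square ..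
  have tr: "tr (insert a I) M = \<alpha> + tr I M"
    using insert.hyps by (simp add: tr_def \<alpha>_def)
  \<comment> \<open>\<open>c\<close> is the rank-one coefficient and \<open>exp (- e)\<close> the
    factor left over from averaging one sign. The first two facts make the remaining form psd with
    smaller Frobenius norm; the third is the one-sign estimate, with \<open>p\<close> for
    \<open>ip I b x\<close>; the fourth balances the exponents, the remaining trace being
    \<open>tr I M - c * \<beta>\<close>.\<close>
  obtain c e where ce: "0 \<le> c" "\<And>x. c * (ip I b x)\<^sup>2 \<le> bf I M x x"
    "\<And>p. (exp (- t * (\<alpha> - 2 * p)) + exp (- t * (\<alpha> + 2 * p))) / 2 \<le> exp (t * c * p\<^sup>2 - e)"
    "t * c * \<beta> - e \<le> - t * \<alpha> + 2 * t\<^sup>2 * (\<alpha>\<^sup>2 + 2 * \<beta>)"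
  proof (cases "2 * t * \<alpha> \<le> 1")
    case True
    show ?thesis
    proof
      \<comment> \<open>Here \<open>e = t * \<alpha>\<close>, and \<open>c = 2 * t\<close> is
        dictated by the bound on cosh:
        \<open>(2 * t * p)\<^sup>2 / 2 = t * c * p\<^sup>2\<close>.\<close>
      show "0 \<le> 2 * t" using assms by simp
      show "2 * t * (ip I b x)\<^sup>2 \<le> bf I M x x" for x
      proof -
        have "0 \<le> \<alpha> * (- 2 * t * ip I b x)\<^sup>2 + 2 * (- 2 * t * ip I b x) * ip I b x + bf I M x x"
          by (rule q)
        also have "\<dots> = (2 * t * \<alpha>) * (2 * t * (ip I b x)\<^sup>2) - 4 * t * (ip I b x)\<^sup>2 + bf I M x x"
          by (simp add: power2_eq_square algebra_simps)
        also have "\<dots> \<le> 1 * (2 * t * (ip I b x)\<^sup>2) - 4 * t * (ip I b x)\<^sup>2 + bf I M x x"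
          using True assms by (intro add_mono diff_mono mult_right_mono) auto
        finally show ?thesis by simp
      qed
      show "(exp (- t * (\<alpha> - 2 * p)) + exp (- t * (\<alpha> + 2 * p))) / 2 \<le> exp (t * (2 * t) * p\<^sup>2 - t * \<alpha>)" for p
      proof -
        have "(exp (- t * (\<alpha> - 2 * p)) + exp (- t * (\<alpha> + 2 * p))) / 2 =
            exp (- t * \<alpha>) * ((exp (2 * t * p) + exp (- (2 * t * p))) / 2)"
          unfolding distrib_left times_divide_eq_right mult_exp_exp
          by (simp add: right_diff_distrib distrib_left mult_ac)
        also have "\<dots> \<le> exp (- t * \<alpha>) * exp ((2 * t * p)\<^sup>2 / 2)"
          by (intro mult_left_mono cosh_le_exp) auto
        also have "\<dots> = exp (t * (2 * t) * p\<^sup>2 - t * \<alpha>)"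
          by (simp add: mult_exp_exp power2_eq_square algebra_simps)
        finally show ?thesis .
      qed
      show "t * (2 * t) * \<beta> - t * \<alpha> \<le> - t * \<alpha> + 2 * t\<^sup>2 * (\<alpha>\<^sup>2 + 2 * \<beta>)"
        using mult_nonneg_nonneg[OF zero_le_square[of t] \<beta>]
          mult_nonneg_nonneg[OF zero_le_square[of t] zero_le_square[of \<alpha>]]
        by (simp add: power2_eq_square algebra_simps)
    qed
  next
    case False
    then have "\<alpha> \<noteq> 0" "t \<noteq> 0" by auto
    then have pos: "\<alpha> > 0" "t > 0" using \<alpha> assms(3) by auto
    have inv: "1 / \<alpha> \<le> 2 * t" using False pos by (simp add: field_simps)
    show ?thesis
    proof
      \<comment> \<open>Here \<open>e = 0\<close>: completing the square bounds each exponential on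
        its own. The trace term \<open>t * \<alpha>\<close> is lost that way, but
        \<open>2 * t * \<alpha> > 1\<close> lets \<open>2 * t\<^sup>2 * \<alpha>\<^sup>2\<close> pay
        for it.\<close>
      show "0 \<le> 1 / \<alpha>" using pos by simp
      show "1 / \<alpha> * (ip I b x)\<^sup>2 \<le> bf I M x x" for x
        using q[of "- ip I b x / \<alpha>" x] pos by (simp add: power2_eq_square field_simps)
      show "(exp (- t * (\<alpha> - 2 * p)) + exp (- t * (\<alpha> + 2 * p))) / 2 \<le> exp (t * (1 / \<alpha>) * p\<^sup>2 - 0)" for p
      proof -
        have "- t * (\<alpha> - 2 * p) \<le> t * (1 / \<alpha>) * p\<^sup>2" "- t * (\<alpha> + 2 * p) \<le> t * (1 / \<alpha>) * p\<^sup>2"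
        proof -
          have "(1 / \<alpha>) * p\<^sup>2 + (\<alpha> - 2 * p) = (p - \<alpha>)\<^sup>2 / \<alpha>"
            "(1 / \<alpha>) * p\<^sup>2 + (\<alpha> + 2 * p) = (p + \<alpha>)\<^sup>2 / \<alpha>"
            using pos by (simp_all add: power2_eq_square field_simps)
          moreover have "0 \<le> (p - \<alpha>)\<^sup>2 / \<alpha>" "0 \<le> (p + \<alpha>)\<^sup>2 / \<alpha>" using pos by auto
          ultimately have *: "- (\<alpha> - 2 * p) \<le> (1 / \<alpha>) * p\<^sup>2" "- (\<alpha> + 2 * p) \<le> (1 / \<alpha>) * p\<^sup>2"
            by linarith+
          show "- t * (\<alpha> - 2 * p) \<le> t * (1 / \<alpha>) * p\<^sup>2"
            using mult_left_mono[OF *(1), of t] pos by (simp add: algebra_simps)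
          show "- t * (\<alpha> + 2 * p) \<le> t * (1 / \<alpha>) * p\<^sup>2"
            using mult_left_mono[OF *(2), of t] pos by (simp add: algebra_simps)
        qed
        then have "exp (- t * (\<alpha> - 2 * p)) \<le> exp (t * (1 / \<alpha>) * p\<^sup>2)"
          "exp (- t * (\<alpha> + 2 * p)) \<le> exp (t * (1 / \<alpha>) * p\<^sup>2)" by auto
        moreover have "(x + y) / 2 \<le> z" if "x \<le> z" "y \<le> z" for x y z :: real
          using that by simp
        ultimately show ?thesis unfolding diff_0_right by blast
      qed
      have "t * (1 / \<alpha>) * \<beta> \<le> t * (2 * t) * \<beta>"
        using inv pos \<beta> by (intro mult_right_mono mult_left_mono) auto
      moreover have "t * \<alpha> * 1 \<le> t * \<alpha> * (2 * t * \<alpha>)"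
        using False pos by (intro mult_left_mono) auto
      moreover have "0 \<le> t * t * \<beta>" using \<beta> by simp
      ultimately show "t * (1 / \<alpha>) * \<beta> - 0 \<le> - t * \<alpha> + 2 * t\<^sup>2 * (\<alpha>\<^sup>2 + 2 * \<beta>)"
        by (simp add: power2_eq_square algebra_simps)
    qed
  qed
  define N where "N = (\<lambda>i j. M i j - c * b i * b j)"
  have bfN: "bf I N x x = bf I M x x - c * (ip I b x)\<^sup>2" for x
    unfolding N_def bf_minus_outer by (simp add: power2_eq_square)
  have psd: "psd_on I N"
    unfolding psd_on_def
  proof (intro conjI allI)
    show "symmetric_on I N"
      unfolding symmetric_on_def
    proof (intro ballI)
      fix i j assume "i \<in> I" "j \<in> I"
      then have "M i j = M j i" using sym by (intro symmetric_onD[OF sym]) auto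
      then show "N i j = N j i" by (simp add: N_def)
    qed
  qed (use ce(2) bfN in auto)
  have trN: "tr I N = tr I M - c * \<beta>"
    by (simp add: tr_def N_def \<beta>_def ip_def sum_subtractf sum_distrib_left mult.assoc)
  have frobN: "frob2 I N \<le> frob2 I M"
    unfolding N_def by (rule frob2_minus_outer_le) (use psd ce in \<open>simp_all add: N_def\<close>)
  have "avg (signs (insert a I)) (\<lambda>x. exp (- t * bf (insert a I) M x x)) \<le>
      avg (signs I) (\<lambda>x. exp (- e) * exp (- t * bf I N x x))"
    unfolding avg_signs_insert[OF insert.hyps]
  proof (rule avg_mono)
    fix x
    have "(exp (- t * bf (insert a I) M (x(a := - 1)) (x(a := - 1))) +
         exp (- t * bf (insert a I) M (x(a := 1)) (x(a := 1)))) / 2 =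
        exp (- t * bf I M x x) * ((exp (- t * (\<alpha> - 2 * ip I b x)) + exp (- t * (\<alpha> + 2 * ip I b x))) / 2)"
      unfolding bf times_divide_eq_right distrib_left mult_exp_exp
      by (simp add: algebra_simps)
    also have "\<dots> \<le> exp (- t * bf I M x x) * exp (t * c * (ip I b x)\<^sup>2 - e)"
      by (intro mult_left_mono ce) auto
    also have "\<dots> = exp (- e) * exp (- t * bf I N x x)"
      unfolding bfN by (simp add: mult_exp_exp algebra_simps)
    finally show "(exp (- t * bf (insert a I) M (x(a := - 1)) (x(a := - 1))) +
         exp (- t * bf (insert a I) M (x(a := 1)) (x(a := 1)))) / 2 \<le> exp (- e) * exp (- t * bf I N x x)" .
  qed
  also have "\<dots> \<le> exp (- e) * exp (- t * tr I N + 2 * t\<^sup>2 * frob2 I N)"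
    unfolding avg_cmult by (intro mult_left_mono insert.IH psd) auto
  also have "\<dots> \<le> exp (- t * tr (insert a I) M + 2 * t\<^sup>2 * frob2 (insert a I) M)"
  proof -
    have "2 * t\<^sup>2 * frob2 I N \<le> 2 * t\<^sup>2 * frob2 I M"
      using frobN by (intro mult_left_mono) auto
    then show ?thesis
      using ce(4) unfolding tr frob trN mult_exp_exp by (simp add: algebra_simps)
  qed
  finally show ?case .
qed

section \<open>Independent sign columns\<close>

definition sign_cols :: "'c set \<Rightarrow> 'i set \<Rightarrow> ('c \<Rightarrow> 'i \<Rightarrow> real) set" where
  "sign_cols J I = PiE J (\<lambda>_. signs I)"

definition comb :: "'c set \<Rightarrow> ('c \<Rightarrow> real) \<Rightarrow> ('c \<Rightarrow> 'i \<Rightarrow> real) \<Rightarrow> 'i \<Rightarrow> real" where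
  "comb J y w = (\<lambda>i. \<Sum>a\<in>J. y a * w a i)"

lemma finite_sign_cols [simp]: "finite J \<Longrightarrow> finite I \<Longrightarrow> finite (sign_cols J I)"
  by (simp add: sign_cols_def finite_PiE_const)

lemma sign_cols_nonempty [simp]: "sign_cols J I \<noteq> {}"
  by (simp add: sign_cols_def PiE_eq_empty_iff)

lemma avg_cols_insert:
  "finite I \<Longrightarrow> finite J \<Longrightarrow> a \<notin> J \<Longrightarrow> avg (sign_cols (insert a J) I) f =
    avg (sign_cols J I) (\<lambda>w. avg (signs I) (\<lambda>g. f (w(a := g))))"
  by (simp add: sign_cols_def avg_PiE_insert)

text \<open>A family of independent sign columns is one sign vector indexed by
  \<open>J \<times> I\<close>, so bounds for a single vector transfer to families.\<close>

lemma avg_signs_Times: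
  assumes "finite J" "finite I"
  shows "avg (signs (J \<times> I)) h = avg (sign_cols J I) (\<lambda>w. h (restrict (\<lambda>(a, i). w a i) (J \<times> I)))"
proof -
  have bij: "bij_betw (\<lambda>w. restrict (\<lambda>(a, i). w a i) (J \<times> I)) (sign_cols J I) (signs (J \<times> I))"
  proof (rule bij_betw_byWitness[where f' = "\<lambda>x. restrict (\<lambda>a. restrict (\<lambda>i. x (a, i)) I) J"])
    show "\<forall>w\<in>sign_cols J I. (\<lambda>a\<in>J. \<lambda>i\<in>I. restrict (\<lambda>(a, i). w a i) (J \<times> I) (a, i)) = w"
    proof (intro ballI ext)
      fix w a i assume "w \<in> sign_cols J I"
      then show "(\<lambda>a\<in>J. \<lambda>i\<in>I. restrict (\<lambda>(a, i). w a i) (J \<times> I) (a, i)) a i = w a i"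
        by (cases "a \<in> J"; cases "i \<in> I")
          (auto simp: sign_cols_def signs_def PiE_iff extensional_def Pi_iff)
    qed
    show "\<forall>x\<in>signs (J \<times> I). restrict (\<lambda>(a, i). (\<lambda>a\<in>J. \<lambda>i\<in>I. x (a, i)) a i) (J \<times> I) = x"
    proof (intro ballI ext)
      fix x p assume "x \<in> signs (J \<times> I)"
      then show "restrict (\<lambda>(a, i). (\<lambda>a\<in>J. \<lambda>i\<in>I. x (a, i)) a i) (J \<times> I) p = x p"
        by (cases p) (auto simp: signs_def PiE_iff extensional_def restrict_def)
    qed
    show "(\<lambda>w. restrict (\<lambda>(a, i). w a i) (J \<times> I)) ` sign_cols J I \<subseteq> signs (J \<times> I)"
      unfolding sign_cols_def signs_def by (rule image_subsetI, rule restrict_PiE_iff[THEN iffD2]) (auto simp: PiE_iff)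
    show "(\<lambda>x. \<lambda>a\<in>J. \<lambda>i\<in>I. x (a, i)) ` signs (J \<times> I) \<subseteq> sign_cols J I"
      unfolding sign_cols_def signs_def
      by (rule image_subsetI, simp only: restrict_PiE_iff, intro ballI) (simp only: PiE_iff mem_Times_iff fst_conv snd_conv)
  qed
  show ?thesis
    unfolding avg_def sum.reindex_bij_betw[OF bij, symmetric] bij_betw_same_card[OF bij, symmetric] ..
qed

lemma bf_eq_ip_mv: "bf I M x y = ip I x (mv I M y)"
  unfolding bf_def ip_def mv_def sum_distrib_left
  by (intro sum.cong refl) (simp only: mult_ac)

lemma bf_commute: "symmetric_on I M \<Longrightarrow> bf I M x y = bf I M y x"
  unfolding bf_def
  by (subst sum.swap, intro sum.cong refl, subst symmetric_onD[of I M], assumption+) (simp only: mult_ac)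

lemma bf_add_left: "bf I M (\<lambda>i. x i + y i) z = bf I M x z + bf I M y z"
  by (simp add: bf_def algebra_simps sum.distrib)

lemma bf_add_right: "bf I M z (\<lambda>i. x i + y i) = bf I M z x + bf I M z y"
  by (simp add: bf_def algebra_simps sum.distrib)

lemma bf_scale_left: "bf I M (\<lambda>i. c * x i) z = c * bf I M x z"
  unfolding bf_def sum_distrib_left by (intro sum.cong refl) (simp only: mult_ac)

lemma bf_scale_right: "bf I M z (\<lambda>i. c * x i) = c * bf I M z x"
  unfolding bf_def sum_distrib_left by (intro sum.cong refl) (simp only: mult_ac)

lemma bf_sum_left: "bf I M (\<lambda>i. \<Sum>a\<in>J. x a i) z = (\<Sum>a\<in>J. bf I M (x a) z)"
  by (induction J rule: infinite_finite_induct) (simp_all add: bf_add_left, simp_all add: bf_def)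

lemma bf_sum_right: "bf I M z (\<lambda>i. \<Sum>a\<in>J. x a i) = (\<Sum>a\<in>J. bf I M z (x a))"
  by (induction J rule: infinite_finite_induct) (simp_all add: bf_add_right, simp_all add: bf_def)

lemma bf_comb:
  "bf I M (comb J y w) (comb J y w) = (\<Sum>a\<in>J. \<Sum>b\<in>J. y a * y b * bf I M (w a) (w b))"
  unfolding comb_def bf_sum_left bf_sum_right bf_scale_left bf_scale_right
  by (simp add: sum_distrib_left mult.assoc)

text \<open>For fixed \<open>y\<close> the form in all signs together has as matrix the Kronecker
  product of \<open>y y^T\<close> and \<open>A\<close>. That product is psd with trace
  \<open>|y|^2 tr A\<close> and Frobenius norm \<open>|y|^2 |A|_F\<close>, so the bound for one
  vector applies.\<close>

lemma avg_cols_exp_psd: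
  assumes "finite J" "finite I" "psd_on I A" "0 \<le> t"
  shows "avg (sign_cols J I) (\<lambda>w. exp (- t * bf I A (comb J y w) (comb J y w))) \<le>
    exp (- t * ((\<Sum>a\<in>J. (y a)\<^sup>2) * tr I A) + 2 * t\<^sup>2 * ((\<Sum>a\<in>J. (y a)\<^sup>2)\<^sup>2 * frob2 I A))"
proof -
  define M where "M = (\<lambda>(a, i) (b, j). y a * y b * A i j)"
  have bf: "bf (J \<times> I) M x x = bf I A (comb J y (\<lambda>a i. x (a, i))) (comb J y (\<lambda>a i. x (a, i)))" for x
  proof -
    have "bf (J \<times> I) M x x =
        (\<Sum>a\<in>J. \<Sum>i\<in>I. \<Sum>b\<in>J. \<Sum>j\<in>I. y a * y b * A i j * x (a, i) * x (b, j))"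
      unfolding bf_def M_def sum.cartesian_product' by simp
    also have "\<dots> = (\<Sum>a\<in>J. \<Sum>b\<in>J. \<Sum>i\<in>I. \<Sum>j\<in>I. y a * y b * A i j * x (a, i) * x (b, j))"
      by (intro sum.cong refl sum.swap)
    also have "\<dots> = (\<Sum>a\<in>J. \<Sum>b\<in>J. y a * y b * bf I A (\<lambda>i. x (a, i)) (\<lambda>i. x (b, i)))"
      unfolding bf_def sum_distrib_left by (intro sum.cong refl) (simp only: mult_ac)
    finally show ?thesis unfolding bf_comb .
  qed
  have psd: "psd_on (J \<times> I) M"
    unfolding psd_on_def
  proof (intro conjI allI)
    show "symmetric_on (J \<times> I) M"
      unfolding symmetric_on_def
    proof (intro ballI)
      fix p q assume pq: "p \<in> J \<times> I" "q \<in> J \<times> I"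
      then have "A (snd p) (snd q) = A (snd q) (snd p)"
        using assms(3) unfolding psd_on_def by (intro symmetric_onD[of I A]) auto
      then show "M p q = M q p"
        by (simp add: M_def case_prod_unfold)
    qed
    show "0 \<le> bf (J \<times> I) M x x" for x
      using assms(3) unfolding bf psd_on_def by blast
  qed
  have tr: "tr (J \<times> I) M = (\<Sum>a\<in>J. (y a)\<^sup>2) * tr I A"
    unfolding tr_def M_def sum_product sum.cartesian_product
    by (simp add: case_prod_unfold power2_eq_square)
  have "frob2 (J \<times> I) M = (\<Sum>a\<in>J. \<Sum>i\<in>I. \<Sum>b\<in>J. \<Sum>j\<in>I. (y a)\<^sup>2 * (y b)\<^sup>2 * (A i j)\<^sup>2)"
    unfolding frob2_def M_def sum.cartesian_product' by (simp add: power_mult_distrib)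
  also have "\<dots> = (\<Sum>a\<in>J. \<Sum>b\<in>J. \<Sum>i\<in>I. \<Sum>j\<in>I. (y a)\<^sup>2 * (y b)\<^sup>2 * (A i j)\<^sup>2)"
    by (intro sum.cong refl sum.swap)
  also have "\<dots> = (\<Sum>a\<in>J. \<Sum>b\<in>J. (y a)\<^sup>2 * (y b)\<^sup>2 * frob2 I A)"
    unfolding frob2_def sum_distrib_left ..
  also have "\<dots> = (\<Sum>a\<in>J. (y a)\<^sup>2)\<^sup>2 * frob2 I A"
    unfolding power2_eq_square[of "sum _ _"] sum_product unfolding sum_distrib_right ..
  finally have fr: "frob2 (J \<times> I) M = (\<Sum>a\<in>J. (y a)\<^sup>2)\<^sup>2 * frob2 I A" .
  have "bf (J \<times> I) M (restrict (\<lambda>(a, i). w a i) (J \<times> I)) (restrict (\<lambda>(a, i). w a i) (J \<times> I)) =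
      bf I A (comb J y w) (comb J y w)" for w
  proof -
    have "bf (J \<times> I) M (restrict (\<lambda>(a, i). w a i) (J \<times> I)) (restrict (\<lambda>(a, i). w a i) (J \<times> I)) =
        bf (J \<times> I) M (\<lambda>(a, i). w a i) (\<lambda>(a, i). w a i)"
      unfolding bf_def by (intro sum.cong refl) auto
    then show ?thesis unfolding bf by simp
  qed
  then show ?thesis
    using avg_signs_exp_psd[OF _ psd assms(4)] assms(1,2)
    unfolding tr fr by (simp add: avg_signs_Times)
qed

section \<open>Second moments of the sketch entries\<close>

definition gram :: "'c set \<Rightarrow> ('c \<Rightarrow> 'i \<Rightarrow> real) \<Rightarrow> 'i \<Rightarrow> 'i \<Rightarrow> real" where
  "gram K v = (\<lambda>i j. \<Sum>b\<in>K. v b i * v b j)"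

lemma symmetric_on_gram: "symmetric_on I (gram K v)"
  by (simp add: symmetric_on_def gram_def mult.commute)

lemma tr_gram: "tr I (gram K v) = (\<Sum>b\<in>K. ip I (v b) (v b))"
  unfolding tr_def gram_def ip_def by (rule sum.swap)

lemma bf_gram: "bf I (gram K v) x x = (\<Sum>b\<in>K. (ip I x (v b))\<^sup>2)"
proof -
  have "bf I (gram K v) x x = (\<Sum>i\<in>I. \<Sum>j\<in>I. \<Sum>b\<in>K. v b i * v b j * x i * x j)"
    by (simp add: bf_def gram_def sum_distrib_right)
  also have "\<dots> = (\<Sum>i\<in>I. \<Sum>b\<in>K. \<Sum>j\<in>I. v b i * v b j * x i * x j)"
    by (rule sum.cong[OF refl], rule sum.swap)
  also have "\<dots> = (\<Sum>b\<in>K. \<Sum>i\<in>I. \<Sum>j\<in>I. v b i * v b j * x i * x j)"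
    by (rule sum.swap)
  also have "\<dots> = (\<Sum>b\<in>K. (ip I x (v b))\<^sup>2)"
    unfolding ip_def power2_eq_square sum_product by (intro sum.cong refl) (simp only: mult_ac)
  finally show ?thesis .
qed

text \<open>Each entry of a Gram matrix is bounded by Cauchy-Schwarz through its two diagonal
  entries, hence the Frobenius norm by the trace.\<close>

lemma frob2_gram_le: "frob2 I (gram K v) \<le> (tr I (gram K v))\<^sup>2"
proof -
  have "(gram K v i j)\<^sup>2 \<le> gram K v i i * gram K v j j" for i j
    using Cauchy_Schwarz_ineq_sum[of "\<lambda>b. v b i" "\<lambda>b. v b j" K]
    by (simp add: gram_def power2_eq_square)
  then have "frob2 I (gram K v) \<le> (\<Sum>i\<in>I. \<Sum>j\<in>I. gram K v i i * gram K v j j)"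
    unfolding frob2_def by (intro sum_mono)
  then show ?thesis by (simp add: tr_def power2_eq_square sum_product)
qed

lemma avg_signs_ip_sq: "finite I \<Longrightarrow> avg (signs I) (\<lambda>x. (ip I x u)\<^sup>2) = ip I u u"
  using avg_signs_ip_ip[of I u u] by (simp add: power2_eq_square)

lemma ip_mv_adjoint: "symmetric_on I M \<Longrightarrow> ip I (mv I M x) y = ip I x (mv I M y)"
  using bf_commute[of I M x y] unfolding bf_eq_ip_mv by (simp add: ip_commute)

lemma frob2_rows: "frob2 I M = (\<Sum>i\<in>I. ip I (M i) (M i))"
  by (simp add: frob2_def ip_def power2_eq_square)

lemma mv_eq_ip: "mv I M x i = ip I x (M i)"
  by (simp add: mv_def ip_def mult.commute)

lemma avg_signs_norm_mv:
  "finite I \<Longrightarrow> avg (signs I) (\<lambda>x. ip I (mv I M x) (mv I M x)) = frob2 I M"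
  unfolding ip_def[of I "mv I M _"] mv_eq_ip avg_sum frob2_rows
  by (simp add: avg_signs_ip_ip)

text \<open>Variances of independent columns add: the cross term vanishes because the form in the
  new column, once centred, has mean zero.\<close>

lemma avg_cols_sum_bf:
  assumes "finite J" "finite I" "symmetric_on I P"
  shows "avg (sign_cols J I) (\<lambda>w. ((\<Sum>a\<in>J. bf I P (w a) (w a)) - real (card J) * tr I P)\<^sup>2)
    \<le> 2 * real (card J) * frob2 I P"
  using assms(1)
proof (induction J)
  case empty
  then show ?case by (simp add: avg_def sign_cols_def)
next
  case (insert c J)
  let ?s = "\<lambda>w. (\<Sum>a\<in>J. bf I P (w a) (w a)) - real (card J) * tr I P"
  have "((\<Sum>a\<in>insert c J. bf I P ((w(c := g)) a) ((w(c := g)) a)) - real (card (insert c J)) * tr I P)\<^sup>2 =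
      (?s w)\<^sup>2 + (2 * ?s w) * (bf I P g g - tr I P) + (bf I P g g - tr I P)\<^sup>2" for w g
  proof -
    have "(\<Sum>a\<in>J. bf I P ((w(c := g)) a) ((w(c := g)) a)) = (\<Sum>a\<in>J. bf I P (w a) (w a))"
      using insert.hyps by (intro sum.cong) auto
    then have "(\<Sum>a\<in>insert c J. bf I P ((w(c := g)) a) ((w(c := g)) a)) - real (card (insert c J)) * tr I P =
        ?s w + (bf I P g g - tr I P)"
      using insert.hyps by (simp add: algebra_simps)
    then show ?thesis by (simp only: power2_sum)
  qed
  then have "avg (sign_cols (insert c J) I) (\<lambda>w. ((\<Sum>a\<in>insert c J. bf I P (w a) (w a)) - real (card (insert c J)) * tr I P)\<^sup>2)
      = avg (sign_cols J I) (\<lambda>w. (?s w)\<^sup>2 + avg (signs I) (\<lambda>g. (bf I P g g - tr I P)\<^sup>2))"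
    using assms(2) insert.hyps
    by (simp only: avg_cols_insert avg_add avg_cmult avg_diff avg_const avg_signs_bf finite_signs
      signs_nonempty not_False_eq_True) (simp add: avg_const)
  also have "\<dots> = avg (sign_cols J I) (\<lambda>w. (?s w)\<^sup>2) + avg (signs I) (\<lambda>g. (bf I P g g - tr I P)\<^sup>2)"
    using assms(2) insert.hyps by (simp add: avg_add avg_const)
  also have "\<dots> \<le> 2 * real (card J) * frob2 I P + 2 * frob2 I P"
    by (intro add_mono insert.IH avg_signs_var assms)
  finally show ?case using insert.hyps by (simp add: algebra_simps)
qed

text \<open>Each entry of \<open>X - (tr A) I\<close> has second moment at most
  \<open>2 |A|_F^2\<close>: off the diagonal by averaging one column with the other frozen, on it by
  the variance bound. The resulting Frobenius bound later pays for both the estimated trace and the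
  rounding.\<close>

lemma avg_cols_entries:
  assumes "finite J" "finite I" "symmetric_on I A"
  shows "avg (sign_cols J I) (\<lambda>w. \<Sum>a\<in>J. \<Sum>b\<in>J. (bf I A (w a) (w b) - (if a = b then tr I A else 0))\<^sup>2)
    \<le> 2 * (real (card J))\<^sup>2 * frob2 I A"
  using assms(1)
proof (induction J)
  case empty
  then show ?case by (simp add: avg_def sign_cols_def)
next
  case (insert c J)
  let ?e = "\<lambda>w a b. (bf I A (w a) (w b) - (if a = b then tr I A else 0))\<^sup>2"
  have eq: "(\<Sum>a\<in>insert c J. \<Sum>b\<in>insert c J. ?e (w(c := g)) a b) =
      (\<Sum>a\<in>J. \<Sum>b\<in>J. ?e w a b) + 2 * (\<Sum>a\<in>J. (ip I g (mv I A (w a)))\<^sup>2) + (bf I A g g - tr I A)\<^sup>2" for w g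
  proof -
    have 1: "(\<Sum>a\<in>J. \<Sum>b\<in>J. ?e (w(c := g)) a b) = (\<Sum>a\<in>J. \<Sum>b\<in>J. ?e w a b)"
      using insert.hyps by (intro sum.cong) auto
    have 2: "(\<Sum>b\<in>J. ?e (w(c := g)) c b) = (\<Sum>a\<in>J. (ip I g (mv I A (w a)))\<^sup>2)"
      using insert.hyps by (intro sum.cong) (auto simp: bf_eq_ip_mv)
    have 3: "(\<Sum>a\<in>J. ?e (w(c := g)) a c) = (\<Sum>a\<in>J. (ip I g (mv I A (w a)))\<^sup>2)"
    proof (intro sum.cong refl)
      fix a assume "a \<in> J"
      then show "?e (w(c := g)) a c = (ip I g (mv I A (w a)))\<^sup>2"
        using insert.hyps trans[OF bf_commute[OF assms(3)] bf_eq_ip_mv, of "w a" g] by auto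
    qed
    show ?thesis
      unfolding sum.insert[OF insert.hyps] sum.distrib 1 2 3 by simp
  qed
  have "avg (sign_cols (insert c J) I) (\<lambda>w. \<Sum>a\<in>insert c J. \<Sum>b\<in>insert c J. ?e w a b) =
      avg (sign_cols J I) (\<lambda>w. (\<Sum>a\<in>J. \<Sum>b\<in>J. ?e w a b) + 2 * (\<Sum>a\<in>J. ip I (mv I A (w a)) (mv I A (w a)))
        + avg (signs I) (\<lambda>g. (bf I A g g - tr I A)\<^sup>2))"
    unfolding avg_cols_insert[OF assms(2) insert.hyps] eq
    using assms(2) by (simp add: avg_add avg_cmult avg_sum avg_const avg_signs_ip_sq)
  also have "\<dots> = avg (sign_cols J I) (\<lambda>w. \<Sum>a\<in>J. \<Sum>b\<in>J. ?e w a b) +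
      2 * avg (sign_cols J I) (\<lambda>w. \<Sum>a\<in>J. ip I (mv I A (w a)) (mv I A (w a))) +
      avg (signs I) (\<lambda>g. (bf I A g g - tr I A)\<^sup>2)"
    using assms(2) insert.hyps by (simp add: avg_add avg_const avg_cmult)
  also have "avg (sign_cols J I) (\<lambda>w. \<Sum>a\<in>J. ip I (mv I A (w a)) (mv I A (w a))) = real (card J) * frob2 I A"
    using insert.hyps(1)
  proof (induction J)
    case empty
    then show ?case by (simp add: avg_def)
  next
    case (insert c J)
    have "(\<Sum>a\<in>insert c J. ip I (mv I A ((w(c := g)) a)) (mv I A ((w(c := g)) a))) =
        ip I (mv I A g) (mv I A g) + (\<Sum>a\<in>J. ip I (mv I A (w a)) (mv I A (w a)))" for w g
    proof -
      have "(\<Sum>a\<in>J. ip I (mv I A ((w(c := g)) a)) (mv I A ((w(c := g)) a))) =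
          (\<Sum>a\<in>J. ip I (mv I A (w a)) (mv I A (w a)))"
        using insert.hyps by (intro sum.cong) auto
      then show ?thesis using insert.hyps by simp
    qed
    then show ?case
      using assms(2) insert
      by (simp only: avg_cols_insert avg_add avg_const avg_signs_norm_mv finite_signs
        signs_nonempty not_False_eq_True finite_sign_cols sign_cols_nonempty card_insert_disjoint) (simp add: algebra_simps)
  qed
  also have "avg (sign_cols J I) (\<lambda>w. \<Sum>a\<in>J. \<Sum>b\<in>J. ?e w a b) + 2 * (real (card J) * frob2 I A)
      + avg (signs I) (\<lambda>g. (bf I A g g - tr I A)\<^sup>2) \<le>
      2 * (real (card J))\<^sup>2 * frob2 I A + 2 * (real (card J) * frob2 I A) + 2 * frob2 I A"
    by (intro add_mono insert.IH avg_signs_var assms order_refl)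
  also have "\<dots> \<le> 2 * (real (card (insert c J)))\<^sup>2 * frob2 I A"
  proof -
    have "0 \<le> real (card J) * frob2 I A" by (simp add: frob2_nonneg)
    then show ?thesis using insert.hyps by (simp add: power2_eq_square algebra_simps)
  qed
  finally show ?case .
qed

text \<open>With the columns \<open>v\<close> of \<open>H\<close> frozen, this is a sum over
  \<open>J\<close> of quadratic forms in the Gram matrix of the vectors \<open>A v_b\<close>; the
  trace of that matrix is again a sum of quadratic forms, in \<open>A^T A\<close>. So the variance
  bound is used twice. The deviation is of order \<open>k^(3/2) |A|_F^2\<close> against the mean
  \<open>k^2 |A|_F^2\<close>.\<close>

lemma avg_cols_cross:
  assumes "finite J" "finite H" "J \<inter> H = {}" "finite I" "symmetric_on I A" "card J = k" "card H = k" "1 \<le> k"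
  shows "avg (sign_cols (J \<union> H) I) (\<lambda>w. ((\<Sum>a\<in>J. \<Sum>b\<in>H. (bf I A (w a) (w b))\<^sup>2) - (real k)\<^sup>2 * frob2 I A)\<^sup>2)
    \<le> 28 * (real k) ^ 3 * (frob2 I A)\<^sup>2"
proof -
  define P where "P = (\<lambda>v. gram H (\<lambda>b. mv I A (v b)))"
  define Q where "Q = gram I A"
  let ?S = "frob2 I A"
  let ?Y = "\<lambda>w v. \<Sum>a\<in>J. bf I (P v) (w a) (w a)"
  have trP: "tr I (P v) = (\<Sum>b\<in>H. bf I Q (v b) (v b))" for v
    unfolding P_def Q_def tr_gram bf_gram ip_def[of I "mv I A _"] mv_eq_ip power2_eq_square ..
  have trQ: "tr I Q = ?S" unfolding Q_def tr_gram frob2_rows ..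
  have Y: "(\<Sum>a\<in>J. \<Sum>b\<in>H. (bf I A (override_on v w J a) (override_on v w J b))\<^sup>2) = ?Y w v" for w v
    unfolding P_def bf_gram bf_eq_ip_mv[of I A] using assms(3)
    by (intro sum.cong refl) (auto simp: override_on_def)
  have "avg (sign_cols (J \<union> H) I) (\<lambda>w. ((\<Sum>a\<in>J. \<Sum>b\<in>H. (bf I A (w a) (w b))\<^sup>2) - (real k)\<^sup>2 * ?S)\<^sup>2) =
      avg (sign_cols H I) (\<lambda>v. avg (sign_cols J I) (\<lambda>w. (?Y w v - (real k)\<^sup>2 * ?S)\<^sup>2))"
    using avg_PiE_Un[of H J "signs I" "\<lambda>w. ((\<Sum>a\<in>J. \<Sum>b\<in>H. (bf I A (w a) (w b))\<^sup>2) - (real k)\<^sup>2 * ?S)\<^sup>2"]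
      assms(1-4) unfolding Y by (simp add: sign_cols_def Un_commute Int_commute)
  also have "\<dots> \<le> avg (sign_cols H I) (\<lambda>v. avg (sign_cols J I) (\<lambda>w. 2 * (?Y w v - real k * tr I (P v))\<^sup>2 +
      2 * (real k)\<^sup>2 * (tr I (P v) - real k * ?S)\<^sup>2))"
  proof (intro avg_mono)
    fix w v
    have "(x - z)\<^sup>2 \<le> 2 * (x - y)\<^sup>2 + 2 * (y - z)\<^sup>2" for x y z :: real
    proof -
      have "0 \<le> ((x - y) - (y - z))\<^sup>2" by simp
      also have "\<dots> = 2 * (x - y)\<^sup>2 + 2 * (y - z)\<^sup>2 - (x - z)\<^sup>2"
        by (simp add: power2_eq_square algebra_simps)
      finally show ?thesis by simp
    qed
    from this[of "?Y w v" "(real k)\<^sup>2 * ?S" "real k * tr I (P v)"]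
    show "(?Y w v - (real k)\<^sup>2 * ?S)\<^sup>2 \<le> 2 * (?Y w v - real k * tr I (P v))\<^sup>2 +
        2 * (real k)\<^sup>2 * (tr I (P v) - real k * ?S)\<^sup>2"
      by (simp add: power2_eq_square algebra_simps)
  qed
  also have "\<dots> \<le> avg (sign_cols H I) (\<lambda>v. 2 * (2 * real k * (tr I (P v))\<^sup>2) +
      2 * (real k)\<^sup>2 * (tr I (P v) - real k * ?S)\<^sup>2)"
  proof (intro avg_mono)
    fix v
    have "avg (sign_cols J I) (\<lambda>w. (?Y w v - real k * tr I (P v))\<^sup>2) \<le> 2 * real k * frob2 I (P v)"
      using avg_cols_sum_bf[OF assms(1,4), of "P v"] assms(6) by (simp add: P_def symmetric_on_gram)
    also have "\<dots> \<le> 2 * real k * (tr I (P v))\<^sup>2"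
      unfolding P_def by (intro mult_left_mono frob2_gram_le) auto
    finally show "avg (sign_cols J I) (\<lambda>w. 2 * (?Y w v - real k * tr I (P v))\<^sup>2 +
        2 * (real k)\<^sup>2 * (tr I (P v) - real k * ?S)\<^sup>2) \<le> 2 * (2 * real k * (tr I (P v))\<^sup>2) +
      2 * (real k)\<^sup>2 * (tr I (P v) - real k * ?S)\<^sup>2"
      using assms by (simp add: avg_add avg_cmult avg_const)
  qed
  also have "\<dots> \<le> avg (sign_cols H I) (\<lambda>v. (8 * real k + 2 * (real k)\<^sup>2) * (tr I (P v) - real k * ?S)\<^sup>2 +
      8 * real k * (real k * ?S)\<^sup>2)"
  proof (intro avg_mono)
    fix v
    have "x\<^sup>2 \<le> 2 * (x - y)\<^sup>2 + 2 * y\<^sup>2" for x y :: real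
    proof -
      have "0 \<le> ((x - y) - y)\<^sup>2" by simp
      also have "\<dots> = 2 * (x - y)\<^sup>2 + 2 * y\<^sup>2 - x\<^sup>2"
        by (simp add: power2_eq_square algebra_simps)
      finally show ?thesis by simp
    qed
    from mult_left_mono[OF this[of "tr I (P v)" "real k * ?S"], of "4 * real k"]
    show "2 * (2 * real k * (tr I (P v))\<^sup>2) + 2 * (real k)\<^sup>2 * (tr I (P v) - real k * ?S)\<^sup>2
       \<le> (8 * real k + 2 * (real k)\<^sup>2) * (tr I (P v) - real k * ?S)\<^sup>2 + 8 * real k * (real k * ?S)\<^sup>2"
      by (simp only: distrib_right distrib_left) simp
  qed
  also have "\<dots> = (8 * real k + 2 * (real k)\<^sup>2) * avg (sign_cols H I) (\<lambda>v. (tr I (P v) - real k * ?S)\<^sup>2) +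
      8 * real k * (real k * ?S)\<^sup>2"
    using assms by (simp add: avg_add avg_cmult avg_const)
  also have "\<dots> \<le> (8 * real k + 2 * (real k)\<^sup>2) * (2 * real k * ?S\<^sup>2) + 8 * real k * (real k * ?S)\<^sup>2"
  proof (intro add_mono mult_left_mono order_refl)
    have "avg (sign_cols H I) (\<lambda>v. (tr I (P v) - real k * ?S)\<^sup>2) \<le> 2 * real k * frob2 I Q"
      using avg_cols_sum_bf[OF assms(2,4), of Q] assms(7) trQ by (simp add: trP Q_def symmetric_on_gram)
    also have "\<dots> \<le> 2 * real k * ?S\<^sup>2"
      using frob2_gram_le[of I I A] trQ by (intro mult_left_mono) (auto simp: Q_def)
    finally show "avg (sign_cols H I) (\<lambda>v. (tr I (P v) - real k * ?S)\<^sup>2) \<le> 2 * real k * ?S\<^sup>2" .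
  qed auto
  also have "\<dots> = (16 * (real k)\<^sup>2 + 12 * (real k) ^ 3) * ?S\<^sup>2"
    by (simp add: power2_eq_square power3_eq_cube algebra_simps)
  also have "\<dots> \<le> 28 * (real k) ^ 3 * ?S\<^sup>2"
  proof (intro mult_right_mono)
    have "(real k)\<^sup>2 * 1 \<le> (real k)\<^sup>2 * real k" using assms(8) by (intro mult_left_mono) auto
    then show "16 * (real k)\<^sup>2 + 12 * (real k) ^ 3 \<le> 28 * (real k) ^ 3"
      by (simp add: power2_eq_square power3_eq_cube)
  qed simp
  finally show ?thesis .
qed

text \<open>This is \<open>W W^T u\<close> for the matrix \<open>W\<close> with columns
  \<open>w a\<close>: the combination of columns with coefficients \<open>W^T u\<close>, which up to
  scaling is the direction that exposes a negative eigenvalue.\<close>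

definition wsum :: "'c set \<Rightarrow> 'i set \<Rightarrow> ('i \<Rightarrow> real) \<Rightarrow> ('c \<Rightarrow> 'i \<Rightarrow> real) \<Rightarrow> 'i \<Rightarrow> real" where
  "wsum J I u w = comb J (\<lambda>a. ip I (w a) u) w"

lemma wsum_insert:
  assumes "finite J" "c \<notin> J"
  shows "wsum (insert c J) I u (w(c := g)) = (\<lambda>i. wsum J I u w i + ip I g u * g i)"
proof
  fix i
  have "(\<Sum>a\<in>J. ip I ((w(c := g)) a) u * (w(c := g)) a i) = (\<Sum>a\<in>J. ip I (w a) u * w a i)"
    using assms by (intro sum.cong) auto
  then show "wsum (insert c J) I u (w(c := g)) i = wsum J I u w i + ip I g u * g i"
    using assms by (simp add: wsum_def comb_def)
qed

lemma mv_add: "mv I M (\<lambda>i. x i + y i) = (\<lambda>i. mv I M x i + mv I M y i)"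
  by (simp add: mv_def algebra_simps sum.distrib)

lemma mv_scale: "mv I M (\<lambda>i. c * x i) = (\<lambda>i. c * mv I M x i)"
  unfolding mv_def sum_distrib_left by (intro ext sum.cong refl) (simp only: mult_ac)

lemma ip_add_left: "ip I (\<lambda>i. x i + y i) z = ip I x z + ip I y z"
  by (simp add: ip_def algebra_simps sum.distrib)

lemma ip_add_right: "ip I z (\<lambda>i. x i + y i) = ip I z x + ip I z y"
  by (simp add: ip_def algebra_simps sum.distrib)

lemma ip_scale_left: "ip I (\<lambda>i. c * x i) z = c * ip I x z"
  unfolding ip_def sum_distrib_left by (intro sum.cong refl) (simp only: mult_ac)

lemma ip_scale_right: "ip I z (\<lambda>i. c * x i) = c * ip I z x"
  unfolding ip_def sum_distrib_left by (intro sum.cong refl) (simp only: mult_ac)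

lemma ip_sum_right: "ip I x (\<lambda>i. \<Sum>a\<in>J. v a i) = (\<Sum>a\<in>J. ip I x (v a))"
  unfolding ip_def sum_distrib_left by (rule sum.swap)

lemma ip_zero_left: "(\<And>i. i \<in> I \<Longrightarrow> x i = 0) \<Longrightarrow> ip I x y = 0"
  by (simp add: ip_def)

text \<open>What remains is the sum over pairs \<open>a \<noteq> b\<close> of
  \<open>(w a . u) (w b . u) (w a)^T M (w b)\<close>. Adding columns one at a time makes it a
  martingale when \<open>M\<close> is symmetric with \<open>M u = 0\<close>; the diagonal terms need
  a separate bound.\<close>

definition offdiag ::
  "'c set \<Rightarrow> 'i set \<Rightarrow> ('i \<Rightarrow> real) \<Rightarrow> ('i \<Rightarrow> 'i \<Rightarrow> real) \<Rightarrow> ('c \<Rightarrow> 'i \<Rightarrow> real) \<Rightarrow> real" where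
  "offdiag J I u M w = bf I M (wsum J I u w) (wsum J I u w)
     - (\<Sum>a\<in>J. (ip I (w a) u)\<^sup>2 * bf I M (w a) (w a))"

section \<open>Moments for a symmetric matrix that annihilates a unit vector\<close>

context
  fixes I :: "'i set" and u :: "'i \<Rightarrow> real" and M :: "'i \<Rightarrow> 'i \<Rightarrow> real"
  assumes finite: "finite I" and sym: "symmetric_on I M" and unit: "ip I u u = 1"
    and ker: "\<And>i. i \<in> I \<Longrightarrow> mv I M u i = 0"
begin

lemma ip_mv_ker: "ip I u (mv I M x) = 0"
  using ip_mv_adjoint[OF sym, of u x] ip_zero_left[of I "mv I M u" x] ker by simp

lemma avg_signs_weighted_norm:
  "avg (signs I) (\<lambda>g. (ip I g u)\<^sup>2 * ip I (mv I M g) (mv I M g)) \<le> 3 * frob2 I M"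
proof -
  have "(ip I g u)\<^sup>2 * ip I (mv I M g) (mv I M g) = (\<Sum>i\<in>I. (ip I g u * ip I g (M i))\<^sup>2)" for g
    unfolding ip_def[of I "mv I M _"] mv_eq_ip sum_distrib_left
    by (simp add: power2_eq_square mult_ac)
  then have "avg (signs I) (\<lambda>g. (ip I g u)\<^sup>2 * ip I (mv I M g) (mv I M g)) =
      (\<Sum>i\<in>I. avg (signs I) (\<lambda>g. (ip I g u * ip I g (M i))\<^sup>2))"
    by (simp only: avg_sum)
  also have "\<dots> \<le> (\<Sum>i\<in>I. 3 * ip I (M i) (M i))"
    using avg_signs_fourth[OF finite, of u] unit by (intro sum_mono) auto
  finally show ?thesis by (simp add: frob2_rows sum_distrib_left)
qed

text \<open>The summands \<open>(g . u) M g\<close> are independent with mean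
  \<open>M u = 0\<close>, so their squared norms add and growth is linear in the number of columns;
  a nonzero mean would make it quadratic.\<close>

lemma avg_cols_norm_mv_wsum:
  assumes "finite J"
  shows "avg (sign_cols J I) (\<lambda>w. ip I (mv I M (wsum J I u w)) (mv I M (wsum J I u w)))
    \<le> 3 * real (card J) * frob2 I M"
  using assms
proof (induction J)
  case empty
  then show ?case by (simp add: avg_def sign_cols_def wsum_def comb_def ip_def mv_def)
next
  case (insert c J)
  let ?v = "\<lambda>w. mv I M (wsum J I u w)"
  have eq: "ip I (mv I M (wsum (insert c J) I u (w(c := g)))) (mv I M (wsum (insert c J) I u (w(c := g)))) =
      ip I (?v w) (?v w) + 2 * (ip I g u * ip I g (mv I M (?v w))) + (ip I g u)\<^sup>2 * ip I (mv I M g) (mv I M g)" for w g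
  proof -
    have "ip I (?v w) (mv I M g) = ip I g (mv I M (?v w))" "ip I (mv I M g) (?v w) = ip I g (mv I M (?v w))"
      using ip_mv_adjoint[OF sym, of g "?v w"] by (simp_all add: ip_commute)
    then show ?thesis
      unfolding wsum_insert[OF insert.hyps] mv_add mv_scale ip_add_left ip_add_right ip_scale_left ip_scale_right
      by (simp add: power2_eq_square algebra_simps)
  qed
  have "avg (sign_cols (insert c J) I) (\<lambda>w. ip I (mv I M (wsum (insert c J) I u w)) (mv I M (wsum (insert c J) I u w))) =
      avg (sign_cols J I) (\<lambda>w. ip I (?v w) (?v w)) +
      avg (signs I) (\<lambda>g. (ip I g u)\<^sup>2 * ip I (mv I M g) (mv I M g))"
    unfolding avg_cols_insert[OF finite insert.hyps] eq
    using finite insert.hyps by (simp add: avg_add avg_cmult avg_const avg_signs_ip_ip ip_mv_ker)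
  also have "\<dots> \<le> 3 * real (card J) * frob2 I M + 3 * frob2 I M"
    by (intro add_mono insert.IH avg_signs_weighted_norm)
  finally show ?case using insert.hyps by (simp add: algebra_simps)
qed

text \<open>Since \<open>M u = 0\<close>, each new column contributes a term with conditional mean zero.\<close>

lemma avg_cols_offdiag:
  assumes "finite J"
  shows "avg (sign_cols J I) (\<lambda>w. (offdiag J I u M w)\<^sup>2) \<le> 18 * (real (card J))\<^sup>2 * frob2 I M"
  using assms
proof (induction J)
  case empty
  then show ?case by (simp add: avg_def sign_cols_def wsum_def comb_def bf_def offdiag_def)
next
  case (insert c J)
  let ?v = "\<lambda>w. mv I M (wsum J I u w)"
  let ?U = "\<lambda>w. offdiag J I u M w"
  have eq: "(offdiag (insert c J) I u M (w(c := g)))\<^sup>2 =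
      (?U w)\<^sup>2 + (4 * ?U w) * (ip I g u * ip I g (?v w)) + 4 * (ip I g u * ip I g (?v w))\<^sup>2" for w g
  proof -
    have 1: "(\<Sum>a\<in>J. (ip I ((w(c := g)) a) u)\<^sup>2 * bf I M ((w(c := g)) a) ((w(c := g)) a)) =
        (\<Sum>a\<in>J. (ip I (w a) u)\<^sup>2 * bf I M (w a) (w a))"
      using insert.hyps by (intro sum.cong) auto
    have 2: "bf I M g (wsum J I u w) = ip I g (?v w)" "bf I M (wsum J I u w) g = ip I g (?v w)"
      using bf_commute[OF sym, of g "wsum J I u w"] by (simp_all add: bf_eq_ip_mv[of I M g "wsum J I u w"])
    have "offdiag (insert c J) I u M (w(c := g)) = ?U w + 2 * (ip I g u * ip I g (?v w))"
      unfolding offdiag_def sum.insert[OF insert.hyps] 1 wsum_insert[OF insert.hyps] bf_add_left bf_add_right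
        bf_scale_left bf_scale_right 2
      by (simp add: power2_eq_square)
    then show ?thesis by (simp add: power2_eq_square algebra_simps)
  qed
  have "avg (sign_cols (insert c J) I) (\<lambda>w. (offdiag (insert c J) I u M w)\<^sup>2) =
      avg (sign_cols J I) (\<lambda>w. (?U w)\<^sup>2 + 4 * avg (signs I) (\<lambda>g. (ip I g u * ip I g (?v w))\<^sup>2))"
    unfolding avg_cols_insert[OF finite insert.hyps] eq
    using finite insert.hyps by (simp add: avg_add avg_cmult avg_const avg_signs_ip_ip ip_mv_ker)
  also have "\<dots> \<le> avg (sign_cols J I) (\<lambda>w. (?U w)\<^sup>2 + 4 * (3 * ip I (?v w) (?v w)))"
    using avg_signs_fourth[OF finite, of u] unit
    by (intro avg_mono add_mono mult_left_mono order_refl) auto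
  also have "\<dots> = avg (sign_cols J I) (\<lambda>w. (?U w)\<^sup>2) + 12 * avg (sign_cols J I) (\<lambda>w. ip I (?v w) (?v w))"
    by (simp add: avg_add avg_cmult)
  also have "\<dots> \<le> 18 * (real (card J))\<^sup>2 * frob2 I M + 12 * (3 * real (card J) * frob2 I M)"
    by (intro add_mono insert.IH mult_left_mono avg_cols_norm_mv_wsum insert.hyps) auto
  \<comment> \<open>With \<open>n\<close> columns the increment is \<open>36 n\<close>, and 18 is
    the constant for which \<open>18 ((n + 1)^2 - n^2)\<close> covers it.\<close>
  also have "\<dots> \<le> 18 * (real (card (insert c J)))\<^sup>2 * frob2 I M"
    using insert.hyps frob2_nonneg[of I M] by (simp add: power2_eq_square algebra_simps)
  finally show ?case .
qed

lemma avg_cols_sum_same: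
  assumes "finite J"
  shows "avg (sign_cols J I) (\<lambda>w. \<Sum>a\<in>J. h (w a)) = real (card J) * avg (signs I) h"
  using assms
proof (induction J)
  case empty
  then show ?case by (simp add: avg_def)
next
  case (insert c J)
  have eq: "(\<Sum>a\<in>insert c J. h ((w(c := g)) a)) = h g + (\<Sum>a\<in>J. h (w a))" for w g
  proof -
    have "(\<Sum>a\<in>J. h ((w(c := g)) a)) = (\<Sum>a\<in>J. h (w a))"
      using insert.hyps by (intro sum.cong) auto
    then show ?thesis using insert.hyps by simp
  qed
  show ?case
    unfolding avg_cols_insert[OF finite insert.hyps] eq
    using finite insert by (simp add: avg_add avg_const algebra_simps)
qed

text \<open>A weighted arithmetic-geometric mean splits the product into a fourth moment, at most 3,
  and a variance, at most \<open>2 * \<mu>\<^sup>2\<close>; the weights turn both into multiples of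
  \<open>\<mu>\<close>, namely \<open>3 / 2 + 1 = 5 / 2\<close>. Here \<open>\<mu>\<close> bounds
  the Frobenius norm of \<open>M\<close> and is not an eigenvalue.\<close>

lemma avg_cols_diag:
  assumes "finite J" "0 < \<mu>" "frob2 I M \<le> \<mu>\<^sup>2"
  shows "avg (sign_cols J I) (\<lambda>w. \<Sum>a\<in>J. (ip I (w a) u)\<^sup>2 * \<bar>bf I M (w a) (w a) - tr I M\<bar>)
    \<le> 5 / 2 * real (card J) * \<mu>"
proof -
  have amgm: "p * \<bar>q\<bar> \<le> (\<mu> / 2) * p\<^sup>2 + (1 / (2 * \<mu>)) * q\<^sup>2" for p q :: real
  proof -
    have "0 \<le> (\<mu> * p - \<bar>q\<bar>)\<^sup>2 / (2 * \<mu>)" using assms(2) by simp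
    also have "\<dots> = (\<mu> / 2) * p\<^sup>2 + (1 / (2 * \<mu>)) * \<bar>q\<bar>\<^sup>2 - p * \<bar>q\<bar>"
      using assms(2) by (simp add: power2_eq_square field_simps)
    finally show ?thesis by simp
  qed
  have "avg (signs I) (\<lambda>g. (ip I g u)\<^sup>2 * \<bar>bf I M g g - tr I M\<bar>) \<le>
      avg (signs I) (\<lambda>g. (\<mu> / 2) * (ip I g u * ip I g u)\<^sup>2 + (1 / (2 * \<mu>)) * (bf I M g g - tr I M)\<^sup>2)"
    using amgm[of "(ip I _ u)\<^sup>2"] by (intro avg_mono) (simp add: power2_eq_square)
  also have "\<dots> = (\<mu> / 2) * avg (signs I) (\<lambda>g. (ip I g u * ip I g u)\<^sup>2) +
      (1 / (2 * \<mu>)) * avg (signs I) (\<lambda>g. (bf I M g g - tr I M)\<^sup>2)"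
    by (simp only: avg_add avg_cmult)
  also have "\<dots> \<le> (\<mu> / 2) * 3 + (1 / (2 * \<mu>)) * (2 * \<mu>\<^sup>2)"
    using avg_signs_fourth[OF finite, of u u] unit avg_signs_var[OF finite sym] assms
    by (intro add_mono mult_left_mono) auto
  also have "\<dots> = 5 / 2 * \<mu>" using assms by (simp add: power2_eq_square)
  finally have "avg (signs I) (\<lambda>g. (ip I g u)\<^sup>2 * \<bar>bf I M g g - tr I M\<bar>) \<le> 5 / 2 * \<mu>" .
  from mult_left_mono[OF this, of "real (card J)"] show ?thesis
    using avg_cols_sum_same[OF assms(1), of "\<lambda>g. (ip I g u)\<^sup>2 * \<bar>bf I M g g - tr I M\<bar>"]
    by (simp add: mult_ac)
qed

lemma avg_cols_norm_unit:
  assumes "finite J"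
  shows "avg (sign_cols J I) (\<lambda>w. ((\<Sum>a\<in>J. (ip I (w a) u)\<^sup>2) - real (card J))\<^sup>2) \<le> 2 * real (card J)"
proof -
  \<comment> \<open>\<open>u u^T\<close> as the Gram matrix of a one-element family: its trace is 1,
    hence its Frobenius norm at most 1, and its form is \<open>(ip I x u)\<^sup>2\<close>.\<close>
  let ?P = "gram {()} (\<lambda>_. u)"
  have tr: "tr I ?P = 1" by (simp add: tr_gram unit)
  then have "frob2 I ?P \<le> 1" using frob2_gram_le[of I "{()}" "\<lambda>_. u"] by simp
  then have "2 * real (card J) * frob2 I ?P \<le> 2 * real (card J)"
    by (simp add: mult_left_le)
  then show ?thesis
    using avg_cols_sum_bf[OF assms finite symmetric_on_gram, of "{()}" "\<lambda>_. u"]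
    by (simp add: tr bf_gram)
qed

end

section \<open>The acceptance test\<close>

text \<open>The bounds suit the rounding of a vector of squared norm at most \<open>3 / 2\<close>:
  coordinates stay within 3 and the squared norm within \<open>2 / k + 3 \<le> 8\<close>. The cap 8
  makes the tail exponent uniform over the grid.\<close>

definition grid :: "nat \<Rightarrow> (nat \<Rightarrow> real) set" where
  "grid k = {y \<in> PiE {..<k} (\<lambda>_. (\<lambda>j. of_int j / real k) ` {- 3 * int k..3 * int k}).
     (\<Sum>a<k. (y a)\<^sup>2) \<le> 8}"

text \<open>Rounding a vector of \<open>\<real>\<^sup>k\<close> to mesh \<open>1 / k\<close> moves it by at most \<open>1 / sqrt k\<close>. The trace is
  subtracted because \<open>X\<close> is centred at \<open>(tr A) I\<close>, and \<open>tr A\<close> is not controlled by \<open>\<parallel>A\<parallel>\<^sub>F\<close> uniformly in the dimension.\<close>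

definition accepts :: "nat \<Rightarrow> real \<Rightarrow> (nat \<Rightarrow> nat \<Rightarrow> real) \<Rightarrow> bool" where
  "accepts k \<epsilon> X \<longleftrightarrow> (\<forall>y\<in>grid k.
     (\<Sum>a<k. \<Sum>b<k. y a * y b * X a b) - (\<Sum>a<k. X a a) / real k * (\<Sum>a<k. (y a)\<^sup>2)
       \<ge> - (\<epsilon> / 16) * sqrt (\<Sum>a<k. \<Sum>b=k..<2 * k. (X a b)\<^sup>2))"

lemma finite_grid [simp]: "finite (grid k)"
  unfolding grid_def by (rule finite_subset[OF Collect_subset], rule finite_PiE) simp_all

lemma card_grid_le: "real (card (grid k)) \<le> (6 * real k + 1) ^ k"
proof -
  let ?T = "(\<lambda>j. of_int j / real k) ` {- 3 * int k..3 * int k}"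
  have "card (grid k) \<le> card (PiE {..<k} (\<lambda>_. ?T))"
    unfolding grid_def by (intro card_mono finite_PiE Collect_subset) simp_all
  also have "\<dots> = card ?T ^ k" by (simp add: card_PiE)
  also have "\<dots> \<le> (6 * k + 1) ^ k"
  proof (rule power_mono)
    have "card ?T \<le> card {- 3 * int k..3 * int k}" by (rule card_image_le) simp
    then show "card ?T \<le> 6 * k + 1" by simp
  qed simp
  finally have "real (card (grid k)) \<le> real ((6 * k + 1) ^ k)" by (rule of_nat_mono)
  then show ?thesis by (simp add: add.commute)
qed

text \<open>By Cauchy-Schwarz against the all-ones vector, the mean of \<open>k\<close> diagonal
  errors is smaller by a factor \<open>sqrt k\<close> than their joint Euclidean size. With
  \<open>N\<close> of order \<open>k F\<close>, the value \<open>tr X / k\<close> is off by order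
  \<open>F sqrt k\<close>.\<close>

lemma trace_deviation:
  fixes X :: "nat \<Rightarrow> nat \<Rightarrow> real"
  assumes "(\<Sum>a<k. \<Sum>b<k. (X a b - (if a = b then t else 0))\<^sup>2) \<le> N\<^sup>2" "0 \<le> N" "1 \<le> k"
  shows "\<bar>(\<Sum>a<k. X a a) / real k - t\<bar> * sqrt (real k) \<le> N"
proof -
  have "(\<Sum>a<k. X a a - t)\<^sup>2 \<le> (\<Sum>a<k. (X a a - t)\<^sup>2) * (\<Sum>a<k. 1\<^sup>2)"
    using Cauchy_Schwarz_ineq_sum[of "\<lambda>a. X a a - t" "\<lambda>_. 1" "{..<k}"] by simp
  moreover have "(\<Sum>a<k. (X a a - t)\<^sup>2) \<le> (\<Sum>a<k. \<Sum>b<k. (X a b - (if a = b then t else 0))\<^sup>2)"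
  proof (rule sum_mono)
    fix a assume "a \<in> {..<k}"
    then show "(X a a - t)\<^sup>2 \<le> (\<Sum>b<k. (X a b - (if a = b then t else 0))\<^sup>2)"
      using member_le_sum[of a "{..<k}" "\<lambda>b. (X a b - (if a = b then t else 0))\<^sup>2"] by simp
  qed
  then have "(\<Sum>a<k. (X a a - t)\<^sup>2) \<le> N\<^sup>2" using assms(1) by linarith
  then have "(\<Sum>a<k. (X a a - t)\<^sup>2) * real k \<le> N\<^sup>2 * real k" by (rule mult_right_mono) simp
  ultimately have "(\<Sum>a<k. X a a - t)\<^sup>2 \<le> N\<^sup>2 * real k" by simp
  moreover have "(\<Sum>a<k. X a a - t) = (\<Sum>a<k. X a a) - real k * t" by (simp add: sum_subtractf)
  moreover have "N\<^sup>2 * real k = (N * sqrt (real k))\<^sup>2" by (simp add: power_mult_distrib)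
  moreover have "0 \<le> N * sqrt (real k)" using assms(2) by simp
  ultimately have 1: "\<bar>(\<Sum>a<k. X a a) - real k * t\<bar> \<le> N * sqrt (real k)"
    by (simp only: power2_le_iff_abs_le)
  have "\<bar>(\<Sum>a<k. X a a) / real k - t\<bar> * real k = \<bar>(\<Sum>a<k. X a a) - real k * t\<bar>"
  proof -
    have "(\<Sum>a<k. X a a) - real k * t = ((\<Sum>a<k. X a a) / real k - t) * real k"
      using assms(3) by (simp add: left_diff_distrib)
    then show ?thesis by (simp only: abs_mult abs_of_nat)
  qed
  also note 1
  finally have "(\<bar>(\<Sum>a<k. X a a) / real k - t\<bar> * sqrt (real k)) * sqrt (real k) \<le> N * sqrt (real k)"
    unfolding mult.assoc real_sqrt_mult_self abs_of_nat .
  then show ?thesis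
    by (rule mult_right_le_imp_le) (use assms(3) in simp)
qed

lemma bilinear_CS:
  fixes G :: "nat \<Rightarrow> nat \<Rightarrow> real"
  shows "(\<Sum>a<k. \<Sum>b<k. G a b * h a b)\<^sup>2 \<le> (\<Sum>a<k. \<Sum>b<k. (G a b)\<^sup>2) * (\<Sum>a<k. \<Sum>b<k. (h a b)\<^sup>2)"
  using Cauchy_Schwarz_ineq_sum[of "\<lambda>p. G (fst p) (snd p)" "\<lambda>p. h (fst p) (snd p)" "{..<k} \<times> {..<k}"]
  unfolding sum.cartesian_product' by simp

text \<open>From \<open>y y^T - z z^T = y (y - z)^T + (y - z) z^T\<close>: moving the vector moves
  its outer product proportionally in Frobenius norm.\<close>

lemma outer_difference:
  fixes y z :: "nat \<Rightarrow> real"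
  assumes "(\<Sum>a<k. (y a - z a)\<^sup>2) \<le> \<delta>" "(\<Sum>a<k. (y a)\<^sup>2) \<le> p" "(\<Sum>a<k. (z a)\<^sup>2) \<le> q"
  shows "(\<Sum>a<k. \<Sum>b<k. (y a * y b - z a * z b)\<^sup>2) \<le> 2 * (p + q) * \<delta>"
proof -
  let ?D = "\<Sum>a<k. (y a - z a)\<^sup>2"
  have D: "0 \<le> ?D" by (simp add: sum_nonneg)
  have "(\<Sum>a<k. \<Sum>b<k. (y a * y b - z a * z b)\<^sup>2) \<le>
      (\<Sum>a<k. \<Sum>b<k. 2 * ((y a)\<^sup>2 * (y b - z b)\<^sup>2 + (y a - z a)\<^sup>2 * (z b)\<^sup>2))"
  proof (intro sum_mono)
    fix a b
    have "0 \<le> (y a * (y b - z b) - (y a - z a) * z b)\<^sup>2" by simp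
    also have "\<dots> = 2 * ((y a)\<^sup>2 * (y b - z b)\<^sup>2 + (y a - z a)\<^sup>2 * (z b)\<^sup>2) - (y a * y b - z a * z b)\<^sup>2"
      by (simp add: power2_eq_square algebra_simps)
    finally show "(y a * y b - z a * z b)\<^sup>2 \<le> 2 * ((y a)\<^sup>2 * (y b - z b)\<^sup>2 + (y a - z a)\<^sup>2 * (z b)\<^sup>2)" by simp
  qed
  also have "\<dots> = 2 * ((\<Sum>a<k. (y a)\<^sup>2) * ?D + ?D * (\<Sum>a<k. (z a)\<^sup>2))"
    by (simp only: sum.distrib sum_distrib_left[symmetric] sum_distrib_right[symmetric])
  also have "\<dots> \<le> 2 * (p * ?D + ?D * q)"
    using assms(2,3) D by (intro mult_left_mono add_mono mult_right_mono) auto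
  also have "\<dots> = 2 * (p + q) * ?D" by (simp add: algebra_simps)
  also have "\<dots> \<le> 2 * (p + q) * \<delta>"
  proof (rule mult_left_mono[OF assms(1)])
    have "0 \<le> p" "0 \<le> q" 
      by (rule order_trans[OF sum_nonneg assms(2)] order_trans[OF sum_nonneg assms(3)], simp)+
    then show "0 \<le> 2 * (p + q)" by simp
  qed
  finally show ?thesis .
qed

lemma avg_cols_restrict:
  fixes k :: nat
  assumes "finite I" "\<And>w v. f (override_on w v {k..<2 * k}) = f w"
  shows "avg (sign_cols {..<2 * k} I) f = avg (sign_cols {..<k} I) f"
proof -
  have eq: "{..<2 * k} = {..<k} \<union> {k..<2 * k}" by (rule ivl_disj_un_one(2)[symmetric]) simp
  have "avg (PiE ({..<k} \<union> {k..<2 * k}) (\<lambda>_. signs I)) f = avg (PiE {..<k} (\<lambda>_. signs I)) f"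
  proof (rule avg_PiE_restrict[of "{..<k}" "{k..<2 * k}" "signs I" f])
    show "f (override_on w v {k..<2 * k}) = f w" for w v by (rule assms(2))
    show "finite (signs I)" by (rule finite_signs[OF assms(1)])
  qed (simp_all add: ivl_disj_int_one(2))
  then show ?thesis
    unfolding sign_cols_def eq .
qed

lemma round_to_grid:
  fixes z :: "nat \<Rightarrow> real"
  assumes "1 \<le> k" "(\<Sum>a<k. (z a)\<^sup>2) \<le> 3 / 2"
  obtains y where "y \<in> grid k" "(\<Sum>a<k. (y a - z a)\<^sup>2) \<le> 1 / real k"
proof
  \<comment> \<open>Coordinatewise floor to mesh \<open>1 / k\<close>: each squared error is at most
    \<open>1 / k^2\<close>, and there are \<open>k\<close> of them.\<close>
  define y where "y = (\<lambda>a\<in>{..<k}. of_int \<lfloor>real k * z a\<rfloor> / real k)"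
  have k: "0 < real k" using assms(1) by simp
  have y: "y a = of_int \<lfloor>real k * z a\<rfloor> / real k" if "a < k" for a
    using that by (simp add: y_def)
  have d: "\<bar>y a - z a\<bar> \<le> 1 / real k" if "a < k" for a
  proof -
    have "(y a - z a) * real k = of_int \<lfloor>real k * z a\<rfloor> - real k * z a"
      using k by (simp add: y[OF that] field_simps)
    moreover have "\<bar>of_int \<lfloor>real k * z a\<rfloor> - real k * z a\<bar> \<le> 1" by linarith
    ultimately have "\<bar>y a - z a\<bar> * real k \<le> 1" using k by (metis abs_mult abs_of_pos)
    then show ?thesis using k by (simp add: pos_le_divide_eq)
  qed
  have "(\<Sum>a<k. (y a - z a)\<^sup>2) \<le> (\<Sum>a<k. (1 / real k)\<^sup>2)"
  proof (rule sum_mono)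
    fix a assume "a \<in> {..<k}"
    then show "(y a - z a)\<^sup>2 \<le> (1 / real k)\<^sup>2"
      using d[of a] power2_le_iff_abs_le[of "1 / real k" "y a - z a"] by simp
  qed
  also have "\<dots> = 1 / real k" using k by (simp add: power2_eq_square)
  finally show D: "(\<Sum>a<k. (y a - z a)\<^sup>2) \<le> 1 / real k" .
  have "(\<Sum>a<k. (y a)\<^sup>2) \<le> (\<Sum>a<k. 2 * (y a - z a)\<^sup>2 + 2 * (z a)\<^sup>2)"
  proof (rule sum_mono)
    fix a
    have "0 \<le> ((y a - z a) - z a)\<^sup>2" by simp
    also have "\<dots> = 2 * (y a - z a)\<^sup>2 + 2 * (z a)\<^sup>2 - (y a)\<^sup>2"
      by (simp add: power2_eq_square algebra_simps)
    finally show "(y a)\<^sup>2 \<le> 2 * (y a - z a)\<^sup>2 + 2 * (z a)\<^sup>2" by simp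
  qed
  also have "\<dots> \<le> 2 * (1 / real k) + 2 * (3 / 2)"
    unfolding sum.distrib sum_distrib_left[symmetric] by (intro add_mono mult_left_mono D assms) auto
  also have "\<dots> \<le> 8" using assms(1) by (simp add: field_simps)
  finally have n: "(\<Sum>a<k. (y a)\<^sup>2) \<le> 8" .
  have "y a \<in> (\<lambda>j. of_int j / real k) ` {- 3 * int k..3 * int k}" if a: "a < k" for a
  proof -
    have "(z a)\<^sup>2 \<le> (\<Sum>a<k. (z a)\<^sup>2)"
      using a by (intro member_le_sum[of a "{..<k}" "\<lambda>a. (z a)\<^sup>2"]) auto
    also have "\<dots> \<le> 2\<^sup>2" using assms(2) by simp
    finally have "\<bar>z a\<bar> \<le> 2" using power2_le_iff_abs_le[of 2 "z a"] by simp
    then have "- 2 \<le> z a" "z a \<le> 2" by auto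
    then have "real k * (- 2) \<le> real k * z a" "real k * z a \<le> real k * 2"
      by (intro mult_left_mono; simp)+
    then have "- 3 * int k \<le> \<lfloor>real k * z a\<rfloor>" "\<lfloor>real k * z a\<rfloor> \<le> 3 * int k"
      by (simp_all add: le_floor_iff floor_le_iff)
    then show ?thesis by (auto simp: y[OF a])
  qed
  then show "y \<in> grid k"
    using n by (auto simp: grid_def y_def PiE_iff)
qed

text \<open>Here \<open>k\<close> is half the sketching dimension: \<open>k\<close> columns are
  tested and \<open>k\<close> more supply the scale. \<open>k1\<close> makes errors of order
  \<open>F sqrt k\<close> negligible against the signal \<open>\<epsilon> k F\<close>, and
  \<open>k2\<close> lets the exponent \<open>\<epsilon>^2 k^2 / 2^21\<close> beat
  \<open>k ln (7 k)\<close>, which bounds the logarithm of the grid size.\<close>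

locale sketch =
  fixes I :: "'i set" and A :: "'i \<Rightarrow> 'i \<Rightarrow> real" and k :: nat and \<epsilon> F :: real
  assumes finite: "finite I" and sym: "symmetric_on I A"
    and eps: "0 < \<epsilon>" "\<epsilon> \<le> 1 / 2"
    and k1: "10 ^ 8 \<le> \<epsilon>\<^sup>2 * real k" and k2: "2 ^ 21 * (ln (7 * real k) + 5) \<le> \<epsilon>\<^sup>2 * real k"
    and F: "0 < F" "F\<^sup>2 = frob2 I A"
begin

lemma k_large: "10 ^ 8 \<le> real k"
proof -
  have "\<epsilon>\<^sup>2 * real k \<le> 1 * real k"
    using eps by (intro mult_right_mono) (auto simp: power_le_one)
  then show ?thesis using k1 by simp
qed

lemma k_pos: "1 \<le> k"
  using k_large by (cases k) auto

lemma sqrt_k_large: "10 ^ 4 * sqrt (real k) \<le> \<epsilon> * real k"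
proof -
  have "(10 ^ 4)\<^sup>2 \<le> (\<epsilon> * sqrt (real k))\<^sup>2"
    using k1 by (simp add: power_mult_distrib)
  then have "10 ^ 4 \<le> \<epsilon> * sqrt (real k)"
    by (rule power2_le_imp_le) (use eps in simp)
  from mult_right_mono[OF this, of "sqrt (real k)"] show ?thesis
    unfolding mult.assoc real_sqrt_mult_self by simp
qed

abbreviation entry :: "(nat \<Rightarrow> 'i \<Rightarrow> real) \<Rightarrow> nat \<Rightarrow> nat \<Rightarrow> real" where
  "entry w a b \<equiv> bf I A (w a) (w b)"

abbreviation cross :: "(nat \<Rightarrow> 'i \<Rightarrow> real) \<Rightarrow> real" where
  "cross w \<equiv> \<Sum>a<k. \<Sum>b=k..<2 * k. (entry w a b)\<^sup>2"

abbreviation dev :: "(nat \<Rightarrow> 'i \<Rightarrow> real) \<Rightarrow> real" where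
  "dev w \<equiv> \<Sum>a<k. \<Sum>b<k. (entry w a b - (if a = b then tr I A else 0))\<^sup>2"

text \<open>The factor 4 encodes relative error \<open>1 / 2\<close>: the quantity is below 1
  exactly when \<open>cross w\<close> differs from \<open>(real k * F)\<^sup>2\<close> by less than
  half of it.\<close>

lemma avg_cross: "avg (sign_cols {..<2 * k} I) (\<lambda>w. 4 * (cross w - (real k * F)\<^sup>2)\<^sup>2 / ((real k * F)\<^sup>2)\<^sup>2) \<le> 1 / 100"
proof -
  have "avg (sign_cols ({..<k} \<union> {k..<2 * k}) I) (\<lambda>w. (cross w - (real k)\<^sup>2 * frob2 I A)\<^sup>2)
      \<le> 28 * real k ^ 3 * (frob2 I A)\<^sup>2"
    by (rule avg_cols_cross) (use finite sym k_pos in auto)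
  moreover have "{..<k} \<union> {k..<2 * k} = {..<2 * k}" by auto
  ultimately have "avg (sign_cols {..<2 * k} I) (\<lambda>w. (cross w - (real k * F)\<^sup>2)\<^sup>2) \<le> 28 * real k ^ 3 * (F\<^sup>2)\<^sup>2"
    by (simp add: F power_mult_distrib)
  then have "avg (sign_cols {..<2 * k} I) (\<lambda>w. 4 * (cross w - (real k * F)\<^sup>2)\<^sup>2 / ((real k * F)\<^sup>2)\<^sup>2) \<le>
      4 * (28 * real k ^ 3 * (F\<^sup>2)\<^sup>2) / ((real k * F)\<^sup>2)\<^sup>2"
    unfolding avg_divide avg_cmult by (intro divide_right_mono mult_left_mono) auto
  also have "\<dots> = 112 / real k"
    using k_pos F(1) by (simp add: power2_eq_square power3_eq_cube field_simps)
  also have "\<dots> \<le> 1 / 100" using k_large by (simp add: field_simps)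
  finally show ?thesis .
qed

lemma avg_dev: "avg (sign_cols {..<2 * k} I) (\<lambda>w. dev w / (200 * (real k * F)\<^sup>2)) \<le> 1 / 100"
proof -
  have "avg (sign_cols {..<2 * k} I) (\<lambda>w. dev w) = avg (sign_cols {..<k} I) (\<lambda>w. dev w)"
    by (rule avg_cols_restrict[OF finite]) (auto intro!: sum.cong simp: override_on_def)
  also have "\<dots> \<le> 2 * (real (card {..<k}))\<^sup>2 * frob2 I A"
    by (rule avg_cols_entries) (use finite sym in auto)
  finally have "avg (sign_cols {..<2 * k} I) (\<lambda>w. dev w) \<le> 2 * (real k * F)\<^sup>2"
    by (simp add: F(2)[symmetric] power_mult_distrib)
  then have "avg (sign_cols {..<2 * k} I) (\<lambda>w. dev w / (200 * (real k * F)\<^sup>2)) \<le> 2 * (real k * F)\<^sup>2 / (200 * (real k * F)\<^sup>2)"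
    unfolding avg_divide by (intro divide_right_mono) auto
  also have "\<dots> = 1 / 100" using k_pos F(1) by simp
  finally show ?thesis .
qed

text \<open>\<open>7 / 10\<close> and \<open>5 / 4\<close> are rational bounds for the square roots
  of \<open>1 / 2\<close> and \<open>3 / 2\<close>.\<close>

lemma cross_bounds:
  assumes "4 * (cross w - (real k * F)\<^sup>2)\<^sup>2 / ((real k * F)\<^sup>2)\<^sup>2 < 1"
  shows "7 / 10 * (real k * F) \<le> sqrt (cross w)" "sqrt (cross w) \<le> 5 / 4 * (real k * F)"
proof -
  have pos: "0 < real k * F" using k_pos F by simp
  have "x - K < K / 2" "K - x < K / 2" if "4 * (x - K)\<^sup>2 / K\<^sup>2 < 1" "0 < K" for x K :: real
  proof -
    have "0 < K\<^sup>2" using that(2) by simp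
    then have "4 * (x - K)\<^sup>2 < K\<^sup>2"
      using that(1) by (simp only: divide_less_eq_1_pos)
    also have "K\<^sup>2 = 4 * (K / 2)\<^sup>2" by (simp add: power_divide)
    finally have "\<bar>x - K\<bar> < \<bar>K / 2\<bar>"
      by (simp only: abs_le_square_iff not_le[symmetric])
    then have "\<bar>x - K\<bar> < K / 2" using that(2) by simp
    then show "x - K < K / 2" "K - x < K / 2" unfolding abs_less_iff by linarith+
  qed
  from this[OF assms zero_less_power[OF pos]]
  have *: "(real k * F)\<^sup>2 / 2 \<le> cross w" "cross w \<le> 3 / 2 * (real k * F)\<^sup>2"
    by linarith+
  show "7 / 10 * (real k * F) \<le> sqrt (cross w)"
  proof (rule real_le_rsqrt)
    have "(7 / 10 * (real k * F))\<^sup>2 = 49 / 100 * (real k * F)\<^sup>2" unfolding power_mult_distrib by (simp add: power2_eq_square)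
    also have "\<dots> \<le> cross w" using *(1) zero_le_power2[of "real k * F"] by linarith
    finally show "(7 / 10 * (real k * F))\<^sup>2 \<le> cross w" .
  qed
  show "sqrt (cross w) \<le> 5 / 4 * (real k * F)"
  proof (rule real_le_lsqrt)
    have "cross w \<le> 25 / 16 * (real k * F)\<^sup>2" using *(2) zero_le_power2[of "real k * F"] by linarith
    also have "\<dots> = (5 / 4 * (real k * F))\<^sup>2" unfolding power_mult_distrib by (simp add: power2_eq_square)
    finally show "cross w \<le> (5 / 4 * (real k * F))\<^sup>2" .
  qed (use pos in \<open>auto intro!: sum_nonneg\<close>)
qed

lemma dev_bound:
  assumes "dev w / (200 * (real k * F)\<^sup>2) < 1"
  shows "dev w \<le> (15 * (real k * F))\<^sup>2"
    "\<bar>(\<Sum>a<k. entry w a a) / real k - tr I A\<bar> \<le> 15 * sqrt (real k) * F"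
proof -
  have pos: "0 < real k * F" using k_pos F by simp
  have "0 < 200 * (real k * F)\<^sup>2" using zero_less_power[OF pos, of 2] by linarith
  then have "dev w \<le> 200 * (real k * F)\<^sup>2" using assms by (simp only: divide_less_eq_1_pos less_imp_le)
  also have "\<dots> \<le> (15 * (real k * F))\<^sup>2"
    unfolding power_mult_distrib[of 15] by (intro mult_right_mono) auto
  finally show *: "dev w \<le> (15 * (real k * F))\<^sup>2" .
  have "\<bar>(\<Sum>a<k. entry w a a) / real k - tr I A\<bar> * sqrt (real k) \<le> 15 * (real k * F)"
    by (rule trace_deviation[OF *]) (use pos k_pos in auto)
  also have "\<dots> = 15 * sqrt (real k) * F * sqrt (real k)" by simp
  finally show "\<bar>(\<Sum>a<k. entry w a a) / real k - tr I A\<bar> \<le> 15 * sqrt (real k) * F"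
    by (rule mult_right_le_imp_le) (use k_pos in simp)
qed

text \<open>An exponential Markov bound at each grid point, summed over the grid, costs
  \<open>1 / 25\<close>; the remaining two terms of \<open>?Z\<close> guard the scale and the
  estimated trace at \<open>1 / 100\<close> each.\<close>

lemma avg_psd_accepts:
  assumes psd: "psd_on I A"
  shows "9 / 10 \<le> avg (sign_cols {..<2 * k} I) (\<lambda>w. of_bool (accepts k \<epsilon> (entry w)))"
proof -
  \<comment> \<open>Half of the tolerated deficit: one \<open>s\<close> for the deviation of the
    form, one for the error of the estimated trace. \<open>2 * s\<close> stays within the threshold
    because \<open>7 / 160 > 1 / 32\<close>.\<close>
  define s where "s = \<epsilon> * real k * F / 64"
  \<comment> \<open>The minimizer of \<open>- t * s + 128 * t\<^sup>2 * F\<^sup>2\<close>, the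
    exponent at the largest squared norm 8; the minimum is
    \<open>- \<epsilon>^2 k^2 / 2^21\<close>.\<close>
  define t where "t = \<epsilon> * real k / (16384 * F)"
  have t: "0 \<le> t" using F eps by (simp add: t_def s_def)
  let ?n = "\<lambda>y::nat \<Rightarrow> real. \<Sum>a<k. (y a)\<^sup>2"
  let ?Q = "\<lambda>y w. \<Sum>a<k. \<Sum>b<k. y a * y b * entry w a b"
  let ?z = "\<lambda>y w. exp (t * (?n y * tr I A - ?Q y w - s))"
  let ?Z = "\<lambda>w. 4 * (cross w - (real k * F)\<^sup>2)\<^sup>2 / ((real k * F)\<^sup>2)\<^sup>2 + dev w / (200 * (real k * F)\<^sup>2) + (\<Sum>y\<in>grid k. ?z y w)"
  have single: "avg (sign_cols {..<2 * k} I) (\<lambda>w. ?z y w) \<le> exp (- (\<epsilon>\<^sup>2 * (real k)\<^sup>2 / 2 ^ 21))" if "y \<in> grid k" for y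
  proof -
    have n: "0 \<le> ?n y" "?n y \<le> 8" using that by (auto simp: grid_def sum_nonneg)
    have "avg (sign_cols {..<2 * k} I) (\<lambda>w. ?z y w) = avg (sign_cols {..<k} I) (\<lambda>w. ?z y w)"
      by (rule avg_cols_restrict[OF finite]) (auto intro!: sum.cong simp: override_on_def)
    also have "\<dots> = avg (sign_cols {..<k} I) (\<lambda>w. exp (t * (?n y * tr I A - s)) * exp (- t * bf I A (comb {..<k} y w) (comb {..<k} y w)))"
      unfolding bf_comb mult_exp_exp by (simp add: algebra_simps)
    also have "\<dots> \<le> exp (t * (?n y * tr I A - s)) * exp (- t * (?n y * tr I A) + 2 * t\<^sup>2 * ((?n y)\<^sup>2 * frob2 I A))"
      unfolding avg_cmult by (intro mult_left_mono avg_cols_exp_psd psd finite t) auto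
    also have "\<dots> = exp (- (t * s) + 2 * t\<^sup>2 * ((?n y)\<^sup>2 * F\<^sup>2))"
      unfolding mult_exp_exp F(2) by (simp add: algebra_simps)
    also have "\<dots> \<le> exp (- (t * s) + 2 * t\<^sup>2 * (8\<^sup>2 * F\<^sup>2))"
      using n by (intro iffD2[OF exp_le_cancel_iff] add_left_mono mult_left_mono mult_right_mono power_mono) auto
    also have "- (t * s) + 2 * t\<^sup>2 * (8\<^sup>2 * F\<^sup>2) = - (\<epsilon>\<^sup>2 * (real k)\<^sup>2 / 2 ^ 21)"
    proof -
      have tF: "t * F = \<epsilon> * real k / 16384" using F(1) by (simp add: t_def)
      have "t * s = \<epsilon> * real k / 64 * (t * F)" by (simp add: s_def)
      also have "\<dots> = \<epsilon>\<^sup>2 * (real k)\<^sup>2 / 2 ^ 20" by (simp add: tF power2_eq_square)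
      finally have "t * s = \<epsilon>\<^sup>2 * (real k)\<^sup>2 / 2 ^ 20" .
      moreover have "2 * t\<^sup>2 * (8\<^sup>2 * F\<^sup>2) = 128 * (t * F)\<^sup>2" by (simp add: power_mult_distrib)
      then have "2 * t\<^sup>2 * (8\<^sup>2 * F\<^sup>2) = \<epsilon>\<^sup>2 * (real k)\<^sup>2 / 2 ^ 21"
        unfolding tF by (simp add: power2_eq_square)
      ultimately show ?thesis by simp
    qed
    finally show ?thesis .
  qed
  have "avg (sign_cols {..<2 * k} I) (\<lambda>w. \<Sum>y\<in>grid k. ?z y w) \<le> (\<Sum>y\<in>grid k. exp (- (\<epsilon>\<^sup>2 * (real k)\<^sup>2 / 2 ^ 21)))"
    unfolding avg_sum by (intro sum_mono single)
  also have "\<dots> = real (card (grid k)) * exp (- (\<epsilon>\<^sup>2 * (real k)\<^sup>2 / 2 ^ 21))" by simp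
  also have "\<dots> \<le> (7 * real k) ^ k * exp (- (\<epsilon>\<^sup>2 * (real k)\<^sup>2 / 2 ^ 21))"
  proof (intro mult_right_mono)
    have "(6 * real k + 1) ^ k \<le> (7 * real k) ^ k" using k_pos by (intro power_mono) auto
    then show "real (card (grid k)) \<le> (7 * real k) ^ k" using card_grid_le[of k] by linarith
  qed simp
  also have "\<dots> = exp (real k * (ln (7 * real k) - \<epsilon>\<^sup>2 * real k / 2 ^ 21))"
  proof -
    have "(7 * real k) ^ k = exp (real k * ln (7 * real k))"
      using k_pos by (simp add: exp_of_nat_mult)
    then show ?thesis by (simp add: mult_exp_exp power2_eq_square algebra_simps)
  qed
  also have "\<dots> \<le> exp (- 5)"
  proof -
    have "real k * (ln (7 * real k) - \<epsilon>\<^sup>2 * real k / 2 ^ 21) \<le> real k * (- 5)"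
      using k2 by (intro mult_left_mono) (auto simp: field_simps)
    also have "\<dots> \<le> - 5" using k_pos by simp
    finally show ?thesis by simp
  qed
  also have "exp (- 5 :: real) \<le> 1 / 25"
  proof -
    have "(2 :: real) ^ 5 \<le> exp 1 ^ 5"
      using exp_ge_add_one_self[of 1] by (intro power_mono) auto
    also have "\<dots> = exp 5" by (simp add: exp_of_nat_mult[of 5 1, symmetric])
    finally have "25 \<le> exp (5 :: real)" by simp
    then show ?thesis by (simp add: exp_minus field_simps)
  qed
  finally have "avg (sign_cols {..<2 * k} I) (\<lambda>w. \<Sum>y\<in>grid k. ?z y w) \<le> 1 / 25" .
  then have Z: "avg (sign_cols {..<2 * k} I) ?Z \<le> 1 / 10"
    using avg_cross avg_dev unfolding avg_add by linarith
  have "1 - 1 / 10 \<le> avg (sign_cols {..<2 * k} I) (\<lambda>w. of_bool (accepts k \<epsilon> (entry w)))"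
  proof (rule avg_of_bool_ge[OF _ _ Z])
    fix w
    have nn: "0 \<le> 4 * (cross w - (real k * F)\<^sup>2)\<^sup>2 / ((real k * F)\<^sup>2)\<^sup>2" "0 \<le> dev w / (200 * (real k * F)\<^sup>2)"
      "0 \<le> (\<Sum>y\<in>grid k. ?z y w)"
      by (auto intro!: sum_nonneg divide_nonneg_nonneg)
    then show "0 \<le> ?Z w" by linarith
    assume "?Z w < 1"
    then have l: "4 * (cross w - (real k * F)\<^sup>2)\<^sup>2 / ((real k * F)\<^sup>2)\<^sup>2 < 1" "dev w / (200 * (real k * F)\<^sup>2) < 1"
      "(\<Sum>y\<in>grid k. ?z y w) < 1" using nn by linarith+
    show "accepts k \<epsilon> (entry w)"
      unfolding accepts_def
    proof
      fix y assume y: "y \<in> grid k"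
      have n: "0 \<le> ?n y" "?n y \<le> 8" using y by (auto simp: grid_def sum_nonneg)
      \<comment> \<open>A sum of exponentials below 1 forces every exponent to be negative, which
        gives the lower bound at all grid points simultaneously.\<close>
      have "?z y w \<le> (\<Sum>y\<in>grid k. ?z y w)"
        by (rule member_le_sum[OF y]) auto
      then have "?z y w < 1" using l(3) by (rule le_less_trans)
      then have "t * (?n y * tr I A - ?Q y w - s) < 0" unfolding exp_less_one_iff .
      then have Q: "?n y * tr I A - s \<le> ?Q y w" using t by (auto simp: mult_less_0_iff)
      have "((\<Sum>a<k. entry w a a) / real k - tr I A) * ?n y \<le> \<bar>(\<Sum>a<k. entry w a a) / real k - tr I A\<bar> * ?n y"
        using n by (intro mult_right_mono) auto
      also have "\<dots> \<le> (15 * sqrt (real k) * F) * 8"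
        using n F by (intro mult_mono dev_bound l) auto
      \<comment> \<open>In units of \<open>F sqrt k\<close> the left side is
        \<open>15 * 8 = 120\<close>, while \<open>s\<close> is at least
        \<open>10^4 / 64 > 156\<close>.\<close>
      also have "\<dots> \<le> s"
      proof -
        have "10 ^ 4 * (sqrt (real k) * F) \<le> \<epsilon> * real k * F"
          using mult_right_mono[OF sqrt_k_large, of F] F(1) by (simp add: mult.assoc)
        moreover have "0 \<le> sqrt (real k) * F" using F(1) by simp
        ultimately show ?thesis unfolding s_def by simp
      qed
      finally have T: "((\<Sum>a<k. entry w a a) / real k - tr I A) * ?n y \<le> s" .
      have "\<epsilon> * (7 / 10 * (real k * F)) \<le> \<epsilon> * sqrt (cross w)"
        using cross_bounds(1)[OF l(1)] eps by (intro mult_left_mono) auto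
      moreover have "0 \<le> \<epsilon> * real k * F" using eps F by simp
      ultimately have "2 * s \<le> \<epsilon> / 16 * sqrt (cross w)" unfolding s_def by (simp only: mult.assoc)
      then show "- (\<epsilon> / 16) * sqrt (cross w) \<le> ?Q y w - (\<Sum>a<k. entry w a a) / real k * ?n y"
        using Q T by (simp add: algebra_simps)
    qed
  qed (use finite in auto)
  then show ?thesis by simp
qed

text \<open>One bad direction is enough, so five Markov bounds of \<open>1 / 100\<close> replace the
  union bound. Along \<open>z = W^T u / sqrt k\<close> the eigenvalue contributes order
  \<open>\<mu> k\<close>, while the rest of the form, with the trace removed, is of order
  \<open>F\<close>.\<close>

lemma avg_far_rejects:
  assumes unit: "ip I u u = 1" and eig: "\<And>i. i \<in> I \<Longrightarrow> mv I A u i = \<mu> * u i"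
    and far: "\<mu> \<le> - \<epsilon> * F"
  shows "9 / 10 \<le> avg (sign_cols {..<2 * k} I) (\<lambda>w. of_bool (\<not> accepts k \<epsilon> (entry w)))"
proof -
  define M where "M = (\<lambda>i j. A i j - \<mu> * u i * u j)"
  have symM: "symmetric_on I M"
    unfolding symmetric_on_def
  proof (intro ballI)
    fix i j assume "i \<in> I" "j \<in> I"
    then show "M i j = M j i" using symmetric_onD[OF sym, of i j] by (simp add: M_def)
  qed
  have kerM: "mv I M u i = 0" if "i \<in> I" for i
  proof -
    have "mv I M u i = mv I A u i - \<mu> * u i * ip I u u"
      unfolding mv_def M_def ip_def by (simp add: left_diff_distrib sum_subtractf sum_distrib_left mult.assoc)
    then show ?thesis using eig[OF that] unit by simp
  qed
  have bfA: "bf I A x z = bf I M x z + \<mu> * ip I u x * ip I u z" for x z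
    unfolding M_def bf_minus_outer by simp
  have trM: "tr I M = tr I A - \<mu>"
    using unit by (simp add: tr_def M_def sum_subtractf ip_def sum_distrib_left[symmetric] mult.assoc)
  \<comment> \<open>Since \<open>u^T M u = 0\<close>, Pythagoras gives
    \<open>|A|_F^2 = |M|_F^2 + \<mu>^2\<close>, so removing the eigenvector cannot raise the
    Frobenius norm.\<close>
  have "bf I M u u = 0"
    unfolding bf_eq_ip_mv using ip_zero_left[of I "mv I M u" u] kerM by (simp add: ip_commute)
  then have frobM: "frob2 I M \<le> F\<^sup>2"
    using frob2_minus_outer[of I A \<mu> u] unit F(2) by (simp add: M_def)
  have k: "0 < real k" "1 \<le> k" using k_pos by auto
  let ?S = "\<lambda>w. \<Sum>a<k. (ip I (w a) u)\<^sup>2"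
  let ?U = "\<lambda>w. offdiag {..<k} I u M w"
  let ?D = "\<lambda>w. \<Sum>a<k. (ip I (w a) u)\<^sup>2 * \<bar>bf I M (w a) (w a) - tr I M\<bar>"
  let ?Z1 = "\<lambda>w. 4 * (cross w - (real k * F)\<^sup>2)\<^sup>2 / ((real k * F)\<^sup>2)\<^sup>2"
  let ?Z2 = "\<lambda>w. dev w / (200 * (real k * F)\<^sup>2)"
  \<comment> \<open>These three control \<open>|W^T u|^2\<close> and the off-diagonal and diagonal
    parts of the form of \<open>M\<close>. A value below 1 means, respectively, an error below
    \<open>k / 2\<close> and sizes below \<open>50 k F\<close> and \<open>250 k F\<close>.\<close>
  let ?Z3 = "\<lambda>w. (?S w - real k)\<^sup>2 / (real k / 2)\<^sup>2"
  let ?Z4 = "\<lambda>w. (?U w)\<^sup>2 / (50 * real k * F)\<^sup>2"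
  let ?Z5 = "\<lambda>w. ?D w / (250 * real k * F)"
  let ?Z = "\<lambda>w. ?Z1 w + ?Z2 w + ?Z3 w + ?Z4 w + ?Z5 w"
  have Z3: "avg (sign_cols {..<2 * k} I) ?Z3 \<le> 1 / 100"
  proof -
    have "avg (sign_cols {..<2 * k} I) ?Z3 = avg (sign_cols {..<k} I) ?Z3"
      by (rule avg_cols_restrict[OF finite]) (simp add: override_on_def)
    also have "\<dots> \<le> 2 * real k / (real k / 2)\<^sup>2"
      unfolding avg_divide using avg_cols_norm_unit[OF finite symM unit kerM, of "{..<k}"]
      by (intro divide_right_mono) auto
    also have "\<dots> = 8 / real k" using k by (simp add: power2_eq_square)
    also have "\<dots> \<le> 1 / 100" using k_large by (simp add: field_simps)
    finally show ?thesis .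
  qed
  have Z4: "avg (sign_cols {..<2 * k} I) ?Z4 \<le> 1 / 100"
  proof -
    have "avg (sign_cols {..<2 * k} I) ?Z4 = avg (sign_cols {..<k} I) ?Z4"
      by (rule avg_cols_restrict[OF finite]) (simp add: offdiag_def wsum_def comb_def override_on_def)
    also have "\<dots> \<le> (18 * (real (card {..<k}))\<^sup>2 * frob2 I M) / (50 * real k * F)\<^sup>2"
      unfolding avg_divide by (intro divide_right_mono avg_cols_offdiag[OF finite symM unit kerM]) auto
    also have "\<dots> \<le> (18 * (real k)\<^sup>2 * F\<^sup>2) / (50 * real k * F)\<^sup>2"
      unfolding card_lessThan by (intro divide_right_mono mult_left_mono frobM) auto
    also have "\<dots> \<le> 1 / 100" using k F(1) by (simp add: power_mult_distrib)
    finally show ?thesis .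
  qed
  have Z5: "avg (sign_cols {..<2 * k} I) ?Z5 \<le> 1 / 100"
  proof -
    have "avg (sign_cols {..<2 * k} I) ?Z5 = avg (sign_cols {..<k} I) ?Z5"
      by (rule avg_cols_restrict[OF finite]) (simp add: override_on_def)
    also have "\<dots> \<le> (5 / 2 * real (card {..<k}) * F) / (250 * real k * F)"
      unfolding avg_divide using k F(1) frobM
      by (intro divide_right_mono avg_cols_diag[OF finite symM unit kerM]) auto
    also have "\<dots> = 1 / 100" using k F(1) by simp
    finally show ?thesis .
  qed
  have Z: "avg (sign_cols {..<2 * k} I) ?Z \<le> 1 / 10"
    using avg_cross avg_dev Z3 Z4 Z5 unfolding avg_add by linarith
  have "1 - 1 / 10 \<le> avg (sign_cols {..<2 * k} I) (\<lambda>w. of_bool (\<not> accepts k \<epsilon> (entry w)))"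
  proof (rule avg_of_bool_ge[OF _ _ Z])
    fix w
    have nn: "0 \<le> ?Z1 w" "0 \<le> ?Z2 w" "0 \<le> ?Z3 w" "0 \<le> ?Z4 w" "0 \<le> ?Z5 w"
      using F(1) by (auto intro!: sum_nonneg divide_nonneg_nonneg)
    then show "0 \<le> ?Z w" by linarith
    assume "?Z w < 1"
    then have l: "?Z1 w < 1" "?Z2 w < 1" "?Z3 w < 1" "?Z4 w < 1" "?Z5 w < 1" using nn by linarith+
    have sq: "\<bar>x\<bar> < c" if "x\<^sup>2 / c\<^sup>2 < 1" "0 < c" for x c :: real
    proof -
      have "0 < c\<^sup>2" using that(2) by simp
      then have "\<not> c\<^sup>2 \<le> x\<^sup>2" using that(1) by (simp add: divide_less_eq_1_pos)
      then have "\<not> \<bar>c\<bar> \<le> \<bar>x\<bar>" unfolding abs_le_square_iff .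
      then show ?thesis using that(2) by simp
    qed
    define r where "r = ?S w / real k"
    define z where "z = (\<lambda>a. ip I (w a) u / sqrt (real k))"
    define t where "t = tr I A"
    define c where "c = (\<Sum>a<k. entry w a a) / real k"
    have "\<bar>?S w - real k\<bar> < real k / 2" by (rule sq[OF l(3)]) (use k in simp)
    then have "real k / 2 \<le> ?S w" "?S w \<le> 3 / 2 * real k" unfolding abs_less_iff by linarith+
    then have r: "1 / 2 \<le> r" "r \<le> 3 / 2" using k by (simp_all add: r_def field_simps)
    have zr: "(\<Sum>a<k. (z a)\<^sup>2) = r"
      by (simp add: z_def r_def power_divide sum_divide_distrib)
    obtain y where y: "y \<in> grid k" and yz: "(\<Sum>a<k. (y a - z a)\<^sup>2) \<le> 1 / real k"
      using round_to_grid[OF k(2), of z] r(2) unfolding zr by blast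
    have n: "0 \<le> (\<Sum>a<k. (y a)\<^sup>2)" "(\<Sum>a<k. (y a)\<^sup>2) \<le> 8" using y by (auto simp: grid_def sum_nonneg)
    let ?Q = "\<lambda>y. \<Sum>a<k. \<Sum>b<k. y a * y b * entry w a b"
    let ?G = "\<lambda>a b. entry w a b - (if a = b then t else 0)"
    have QG: "?Q x = (\<Sum>a<k. \<Sum>b<k. ?G a b * (x a * x b)) + t * (\<Sum>a<k. (x a)\<^sup>2)" for x
    proof -
      have "(\<Sum>a<k. \<Sum>b<k. ?G a b * (x a * x b)) =
          (\<Sum>a<k. \<Sum>b<k. x a * x b * entry w a b - (if a = b then t * (x a * x b) else 0))"
        by (intro sum.cong refl) (simp add: algebra_simps)
      also have "\<dots> = ?Q x - (\<Sum>a<k. t * (x a * x a))"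
        unfolding sum_subtractf by simp
      finally show ?thesis by (simp add: sum_distrib_left power2_eq_square)
    qed
    \<comment> \<open>Rounding is priced against \<open>?G\<close>: with \<open>t\<close> taken off
      the diagonal its Frobenius norm is at most \<open>15 k F\<close>, whatever the trace. The
      outer products differ by at most \<open>5 / sqrt k\<close>, hence the factor 75.\<close>
    have "?Q y - t * (\<Sum>a<k. (y a)\<^sup>2) - (?Q z - t * r) = (\<Sum>a<k. \<Sum>b<k. ?G a b * (y a * y b - z a * z b))"
      unfolding QG zr by (simp only: right_diff_distrib sum_subtractf)
    moreover have "(\<Sum>a<k. \<Sum>b<k. ?G a b * (y a * y b - z a * z b))\<^sup>2 \<le> (75 * sqrt (real k) * F)\<^sup>2"
    proof -
      have "(\<Sum>a<k. \<Sum>b<k. (y a * y b - z a * z b)\<^sup>2) \<le> 2 * (8 + 3 / 2) * (1 / real k)"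
        by (rule outer_difference) (use yz n r zr in auto)
      also have "\<dots> \<le> 25 / real k" using k by (simp add: field_simps)
      finally have "(\<Sum>a<k. \<Sum>b<k. (?G a b)\<^sup>2) * (\<Sum>a<k. \<Sum>b<k. (y a * y b - z a * z b)\<^sup>2) \<le>
          (15 * (real k * F))\<^sup>2 * (25 / real k)"
        using dev_bound(1)[OF l(2)] unfolding t_def by (intro mult_mono) (auto intro!: sum_nonneg)
      also have "\<dots> = (75 * sqrt (real k) * F)\<^sup>2"
        using k by (simp add: power_mult_distrib power2_eq_square[of "real k"])
      finally show ?thesis by (rule order_trans[OF bilinear_CS])
    qed
    ultimately have step1: "?Q y - t * (\<Sum>a<k. (y a)\<^sup>2) \<le> ?Q z - t * r + 75 * sqrt (real k) * F"
      using power2_le_iff_abs_le[of "75 * sqrt (real k) * F"] F(1) by (auto simp: abs_le_iff)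
    have "(t - c) * (\<Sum>a<k. (y a)\<^sup>2) \<le> \<bar>c - t\<bar> * (\<Sum>a<k. (y a)\<^sup>2)"
      using n by (intro mult_right_mono) auto
    also have "\<dots> \<le> (15 * sqrt (real k) * F) * 8"
      unfolding c_def t_def using n F by (intro mult_mono dev_bound l) auto
    finally have step2: "(t - c) * (\<Sum>a<k. (y a)\<^sup>2) \<le> 120 * sqrt (real k) * F" by simp
    have W: "bf I A (comb {..<k} z w) (comb {..<k} z w) = (1 / real k) * bf I A (wsum {..<k} I u w) (wsum {..<k} I u w)"
    proof -
      have "comb {..<k} z w = (\<lambda>i. (1 / sqrt (real k)) * wsum {..<k} I u w i)"
        by (simp add: comb_def wsum_def z_def sum_divide_distrib)
      moreover have "1 / sqrt (real k) * (1 / sqrt (real k)) = 1 / real k" by simp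
      ultimately show ?thesis
        by (simp only: bf_scale_left bf_scale_right mult.assoc[symmetric])
    qed
    have ipW: "ip I u (wsum {..<k} I u w) = real k * r"
    proof -
      have "ip I u (wsum {..<k} I u w) = (\<Sum>a<k. ip I (w a) u * ip I u (w a))"
        unfolding wsum_def comb_def ip_sum_right ip_scale_right ..
      also have "\<dots> = real k * r"
        using k by (simp add: r_def ip_commute[of I u] power2_eq_square)
      finally show ?thesis .
    qed
    have "bf I M (wsum {..<k} I u w) (wsum {..<k} I u w) = ?U w + (\<Sum>a<k. (ip I (w a) u)\<^sup>2 * bf I M (w a) (w a))"
      by (simp add: offdiag_def)
    moreover have "(\<Sum>a<k. (ip I (w a) u)\<^sup>2 * bf I M (w a) (w a)) \<le> ?D w + tr I M * (real k * r)"
    proof -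
      have "(\<Sum>a<k. (ip I (w a) u)\<^sup>2 * bf I M (w a) (w a)) \<le>
          (\<Sum>a<k. (ip I (w a) u)\<^sup>2 * \<bar>bf I M (w a) (w a) - tr I M\<bar> + tr I M * (ip I (w a) u)\<^sup>2)"
      proof (rule sum_mono)
        fix a
        have "(ip I (w a) u)\<^sup>2 * (bf I M (w a) (w a) - tr I M) \<le> (ip I (w a) u)\<^sup>2 * \<bar>bf I M (w a) (w a) - tr I M\<bar>"
          by (intro mult_left_mono) auto
        then show "(ip I (w a) u)\<^sup>2 * bf I M (w a) (w a) \<le>
            (ip I (w a) u)\<^sup>2 * \<bar>bf I M (w a) (w a) - tr I M\<bar> + tr I M * (ip I (w a) u)\<^sup>2"
          unfolding right_diff_distrib by (simp add: mult.commute)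
      qed
      also have "\<dots> = ?D w + tr I M * (real k * r)"
        using k by (simp add: sum.distrib sum_distrib_left[symmetric] r_def)
      finally show ?thesis .
    qed
    moreover have "?U w \<le> 50 * real k * F"
      using sq[OF l(4)] k F(1) by (simp add: abs_less_iff)
    moreover have "?D w \<le> 250 * real k * F"
    proof -
      have "0 < 250 * real k * F" using k F(1) by simp
      then show ?thesis using l(5) by (simp only: divide_less_eq_1_pos less_imp_le)
    qed
    \<comment> \<open>\<open>50 + 250 = 300\<close>; the diagonal part has centre
      \<open>tr I M = t - \<mu>\<close> times \<open>k r\<close>, and the rank-one part that was
      removed returns as \<open>\<mu> (k r)^2\<close>.\<close>
    ultimately have "bf I A (wsum {..<k} I u w) (wsum {..<k} I u w) \<le>
        300 * real k * F + (t - \<mu>) * (real k * r) + \<mu> * (real k * r) * (real k * r)"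
      unfolding bfA ipW trM t_def by linarith
    then have "?Q z \<le> (1 / real k) * (300 * real k * F + (t - \<mu>) * (real k * r) + \<mu> * (real k * r) * (real k * r))"
      unfolding bf_comb[symmetric] W by (intro mult_left_mono) auto
    also have "\<dots> = 300 * F + (t - \<mu>) * r + \<mu> * r * (real k * r)"
      using k by (simp add: distrib_left)
    finally have step3: "?Q z - t * r \<le> 300 * F + \<mu> * (r * (real k * r - 1))"
      by (simp add: algebra_simps)
    have k_large': "100 \<le> real k" using k_large by simp
    define p where "p = r * (real k * r - 1)"
    \<comment> \<open>From \<open>r \<ge> 1 / 2\<close> and \<open>k \<ge> 100\<close> follows
      \<open>k r - 1 \<ge> 2 k / 5\<close>. The \<open>- 1\<close> is the share of
      \<open>\<mu>\<close> in \<open>tr I A\<close>, which goes away with the subtracted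
      trace.\<close>
    have step4: "\<mu> * p \<le> - (\<epsilon> * real k * F) / 5"
    proof -
      have "real k * (1 / 2) \<le> real k * r" using r k by (intro mult_left_mono) auto
      then have "real k * 2 / 5 \<le> real k * r - 1" using k_large' by linarith
      then have "1 / 2 * (real k * 2 / 5) \<le> p"
        unfolding p_def using r(1) by (intro mult_mono) auto
      then have "real k / 5 \<le> p" by simp
      moreover have "0 \<le> \<epsilon> * F" using eps F(1) by simp
      then have "0 \<le> - \<mu>" using far by simp
      ultimately have "(- \<mu>) * (real k / 5) \<le> (- \<mu>) * (p)"
        by (rule mult_left_mono)
      moreover have "(\<epsilon> * F) * (real k / 5) \<le> (- \<mu>) * (real k / 5)"
        using far by (intro mult_right_mono) auto
      ultimately show ?thesis by (simp add: mult_ac)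
    qed
    have skF: "10 ^ 4 * (sqrt (real k) * F) \<le> \<epsilon> * real k * F"
      using mult_right_mono[OF sqrt_k_large, of F] F(1) by (simp add: mult.assoc)
    \<comment> \<open>\<open>300 + 75 + 120 \<le> 500\<close>, and
      \<open>500 / 10^4 = 1 / 20\<close>. What remains is
      \<open>- (1 / 5 - 1 / 20) \<epsilon> k F\<close>, below the threshold, which is at least
      \<open>- (5 / 64) \<epsilon> k F\<close>.\<close>
    have "F \<le> sqrt (real k) * F" using k F(1) by simp
    then have "?Q y - t * (\<Sum>a<k. (y a)\<^sup>2) + (t - c) * (\<Sum>a<k. (y a)\<^sup>2) \<le>
        - (\<epsilon> * real k * F) / 5 + 500 * (sqrt (real k) * F)"
      using step1 step2 step3 step4 F(1) unfolding p_def by linarith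
    then have "?Q y - c * (\<Sum>a<k. (y a)\<^sup>2) \<le> - (\<epsilon> * real k * F) / 5 + 500 * (sqrt (real k) * F)"
      by (simp add: left_diff_distrib)
    moreover have "\<epsilon> * sqrt (cross w) \<le> \<epsilon> * (5 / 4 * (real k * F))"
      using cross_bounds(2)[OF l(1)] eps by (intro mult_left_mono) auto
    moreover have "0 < \<epsilon> * real k * F" using eps k F(1) by simp
    ultimately have "?Q y - c * (\<Sum>a<k. (y a)\<^sup>2) < - (\<epsilon> / 16) * sqrt (cross w)"
      using skF by simp
    then show "\<not> accepts k \<epsilon> (entry w)"
      unfolding accepts_def c_def using y by (auto simp: not_le)
  qed (use finite in auto)
  then show ?thesis by simp
qed

end

section \<open>Matrices\<close>

text \<open>The complexified matrix has an eigenvalue \<open>\<mu>\<close>. By symmetry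
  \<open>v^* A v\<close> equals its own conjugate, so \<open>\<mu>\<close> is real, and the real or
  the imaginary part of \<open>v\<close> is a real eigenvector. This makes the \<open>Min\<close> in
  \<open>lambda_min\<close> a genuine eigenvalue.\<close>

lemma real_symmetric_spectrum_nonempty:
  fixes A :: "real mat"
  assumes A: "A \<in> carrier_mat d d" and d: "0 < d" and sym: "symmetric_mat A"
  shows "spectrum A \<noteq> {}"
proof -
  define B where "B = map_mat complex_of_real A"
  have B: "B \<in> carrier_mat d d" using A by (simp add: B_def)
  obtain \<mu> where "eigenvalue B \<mu>"
    using spectrum_non_empty[OF B d] by (auto simp: spectrum_def)
  then obtain v where v: "v \<in> carrier_vec d" "v \<noteq> 0\<^sub>v d" "B *\<^sub>v v = \<mu> \<cdot>\<^sub>v v"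
    using B by (auto simp: eigenvalue_def eigenvector_def)
  have Aji: "A $$ (j, i) = A $$ (i, j)" if "i < d" "j < d" for i j
    using sym A that unfolding symmetric_mat_def by (metis carrier_matD index_transpose_mat(1))
  have ev: "(\<Sum>j<d. of_real (A $$ (i, j)) * v $ j) = \<mu> * v $ i" if i: "i < d" for i
  proof -
    have "(B *\<^sub>v v) $ i = (\<Sum>j<d. of_real (A $$ (i, j)) * v $ j)"
      using A v(1) i by (simp add: B_def scalar_prod_def lessThan_atLeast0)
    then show ?thesis using v i by simp
  qed
  obtain m where m: "m < d" "v $ m \<noteq> 0"
    using v(1,2) by (metis carrier_vecD eq_vecI index_zero_vec)
  define n where "n = (\<Sum>i<d. (cmod (v $ i))\<^sup>2)"
  have "0 < (cmod (v $ m))\<^sup>2" using m by simp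
  also have "\<dots> \<le> n" unfolding n_def using m by (intro member_le_sum[of m "{..<d}"]) auto
  finally have n: "0 < n" .
  define q where "q = (\<Sum>i<d. \<Sum>j<d. of_real (A $$ (i, j)) * cnj (v $ i) * v $ j)"
  have q: "q = \<mu> * of_real n"
  proof -
    have "q = (\<Sum>i<d. cnj (v $ i) * (\<mu> * v $ i))"
      unfolding q_def
    proof (rule sum.cong[OF refl])
      fix i assume "i \<in> {..<d}"
      then have "(\<Sum>j<d. of_real (A $$ (i, j)) * v $ j) = \<mu> * v $ i" by (intro ev) simp
      then show "(\<Sum>j<d. of_real (A $$ (i, j)) * cnj (v $ i) * v $ j) = cnj (v $ i) * (\<mu> * v $ i)"
        by (simp only: sum_distrib_left[symmetric] mult.assoc mult.left_commute[of _ "cnj (v $ i)"])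
    qed
    also have "\<dots> = \<mu> * (\<Sum>i<d. v $ i * cnj (v $ i))"
      unfolding sum_distrib_left by (intro sum.cong refl) (simp only: mult_ac)
    also have "(\<Sum>i<d. v $ i * cnj (v $ i)) = of_real n"
      unfolding n_def of_real_sum by (intro sum.cong refl) (simp add: complex_norm_square[symmetric])
    finally show ?thesis .
  qed
  have "cnj q = (\<Sum>i<d. \<Sum>j<d. of_real (A $$ (i, j)) * v $ i * cnj (v $ j))"
    by (simp add: q_def)
  also have "\<dots> = (\<Sum>j<d. \<Sum>i<d. of_real (A $$ (i, j)) * v $ i * cnj (v $ j))"
    by (rule sum.swap)
  also have "\<dots> = q"
    unfolding q_def using Aji by (intro sum.cong refl) (auto simp: mult_ac)
  finally have "cnj \<mu> * of_real n = \<mu> * of_real n" using q by (metis complex_cnj_complex_of_real complex_cnj_mult)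
  then have "cnj \<mu> = \<mu>" using n by simp
  then have im: "Im \<mu> = 0" by (simp add: complex_eq_iff)
  have re_ev: "(\<Sum>j<d. A $$ (i, j) * Re (v $ j)) = Re \<mu> * Re (v $ i)"
    "(\<Sum>j<d. A $$ (i, j) * Im (v $ j)) = Re \<mu> * Im (v $ i)" if "i < d" for i
    using arg_cong[OF ev[OF that], of Re] arg_cong[OF ev[OF that], of Im] im by simp_all
  have main: "Re \<mu> \<in> spectrum A"
    if x: "\<And>i. i < d \<Longrightarrow> (\<Sum>j<d. A $$ (i, j) * x j) = Re \<mu> * x i" "x m \<noteq> 0" for x
  proof -
    have "A *\<^sub>v vec d x = Re \<mu> \<cdot>\<^sub>v vec d x"
      using A x(1) by (intro eq_vecI) (auto simp: scalar_prod_def lessThan_atLeast0)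
    moreover have "vec d x \<noteq> 0\<^sub>v d" using x(2) m(1) by (metis index_vec index_zero_vec(1))
    ultimately have "eigenvector A (vec d x) (Re \<mu>)"
      using A by (simp add: eigenvector_def)
    then show ?thesis by (auto simp: spectrum_def eigenvalue_def)
  qed
  have "Re (v $ m) \<noteq> 0 \<or> Im (v $ m) \<noteq> 0" using m(2) by (simp add: complex_eq_iff)
  then show ?thesis using main[OF re_ev(1)] main[OF re_ev(2)] by auto
qed

abbreviation mfun :: "real mat \<Rightarrow> nat \<Rightarrow> nat \<Rightarrow> real" where
  "mfun A \<equiv> \<lambda>i j. A $$ (i, j)"

lemma frobenius_norm_sq: "A \<in> carrier_mat d d \<Longrightarrow> (frobenius_norm A)\<^sup>2 = frob2 {..<d} (mfun A)"
  by (simp add: frobenius_norm_def frob2_def sum_nonneg)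

lemma symmetric_on_mfun: "A \<in> carrier_mat d d \<Longrightarrow> symmetric_mat A \<Longrightarrow> symmetric_on {..<d} (mfun A)"
  unfolding symmetric_mat_def symmetric_on_def by (metis carrier_matD index_transpose_mat(1) lessThan_iff)

lemma psd_on_mfun:
  assumes A: "A \<in> carrier_mat d d" and "psd_mat A"
  shows "psd_on {..<d} (mfun A)"
  unfolding psd_on_def
proof (intro conjI allI)
  show "symmetric_on {..<d} (mfun A)" using assms by (auto simp: psd_mat_def intro: symmetric_on_mfun)
  fix x
  have "scalar_prod (vec d x) (A *\<^sub>v vec d x) = (\<Sum>i<d. x i * (\<Sum>j<d. A $$ (i, j) * x j))"
    using A by (simp add: scalar_prod_def lessThan_atLeast0)
  also have "\<dots> = bf {..<d} (mfun A) x x"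
    unfolding bf_eq_ip_mv by (simp add: ip_def mv_def)
  finally have "scalar_prod (vec d x) (A *\<^sub>v vec d x) = bf {..<d} (mfun A) x x" .
  moreover have "0 \<le> scalar_prod (vec d x) (A *\<^sub>v vec d x)"
    using assms by (auto simp: psd_mat_def)
  ultimately show "0 \<le> bf {..<d} (mfun A) x x" by simp
qed

lemma lambda_min_eigenvector:
  assumes A: "A \<in> carrier_mat d d" and d: "0 < d" and sym: "symmetric_mat A"
  obtains u where "ip {..<d} u u = 1" "\<And>i. i < d \<Longrightarrow> mv {..<d} (mfun A) u i = lambda_min A * u i"
proof -
  have "lambda_min A \<in> spectrum A"
    unfolding lambda_min_def using card_finite_spectrum[OF A] real_symmetric_spectrum_nonempty[OF assms]
    by (intro Min_in)
  then obtain v where v: "v \<in> carrier_vec d" "v \<noteq> 0\<^sub>v d" "A *\<^sub>v v = lambda_min A \<cdot>\<^sub>v v"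
    using A by (auto simp: spectrum_def eigenvalue_def eigenvector_def)
  have ev: "(\<Sum>j<d. A $$ (i, j) * v $ j) = lambda_min A * v $ i" if i: "i < d" for i
  proof -
    have "(A *\<^sub>v v) $ i = (\<Sum>j<d. A $$ (i, j) * v $ j)"
      using A v(1) i by (simp add: scalar_prod_def lessThan_atLeast0)
    then show ?thesis using v i by simp
  qed
  obtain m where m: "m < d" "v $ m \<noteq> 0"
    using v(1,2) by (metis carrier_vecD eq_vecI index_zero_vec)
  define n where "n = ip {..<d} (($) v) (($) v)"
  have "0 < v $ m * v $ m" using m(2) not_real_square_gt_zero by blast
  also have "\<dots> \<le> n" unfolding n_def ip_def
    using m by (intro member_le_sum[of m "{..<d}" "\<lambda>i. v $ i * v $ i"]) auto
  finally have n: "0 < n" .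
  let ?u = "\<lambda>i. (1 / sqrt n) * v $ i"
  have "ip {..<d} ?u ?u = (1 / sqrt n) * ((1 / sqrt n) * n)"
    unfolding ip_scale_left ip_scale_right n_def ..
  also have "\<dots> = 1" using n by (simp add: field_simps)
  finally have "ip {..<d} ?u ?u = 1" .
  moreover have "mv {..<d} (mfun A) ?u i = lambda_min A * ?u i" if "i < d" for i
    unfolding mv_scale using ev[OF that] by (simp add: mv_def)
  ultimately show thesis by (rule that)
qed

text \<open>With \<open>L = ln (1 / \<epsilon>)\<close> and \<open>k\<close> of order
  \<open>(L / \<epsilon>)^2\<close>, \<open>ln k\<close> grows like \<open>2 L + 2 ln L\<close>
  while \<open>\<epsilon>^2 k\<close> is of order \<open>L^2\<close>. The bound
  \<open>\<epsilon> \<le> 1 / 2\<close> keeps \<open>L\<close> above \<open>2 / 3\<close>, so that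
  \<open>L^2\<close> absorbs additive constants.\<close>

lemma choose_dimension:
  fixes \<epsilon> :: real
  assumes "0 < \<epsilon>" "\<epsilon> \<le> 1 / 2"
  obtains k :: nat where "10 ^ 8 \<le> \<epsilon>\<^sup>2 * real k" "2 ^ 21 * (ln (7 * real k) + 5) \<le> \<epsilon>\<^sup>2 * real k"
    "real (2 * k) \<le> 2 ^ 32 * (1 / \<epsilon>\<^sup>2) * (ln (1 / \<epsilon>))\<^sup>2"
proof
  define L where "L = ln (1 / \<epsilon>)"
  define q where "q = L / \<epsilon>"
  define k where "k = nat \<lceil>2 ^ 30 * q\<^sup>2\<rceil>"
  have "ln 2 \<le> L" unfolding L_def using assms by (subst ln_le_cancel_iff) (auto simp: field_simps)
  then have L: "2 / 3 \<le> L" using ln2_ge_two_thirds by linarith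
  have "1 * \<epsilon> \<le> L" using L assms(2) by linarith
  then have q: "1 \<le> q" using assms(1) by (simp add: q_def pos_le_divide_eq)
  have q2: "1 \<le> q\<^sup>2" using q by simp
  have k: "2 ^ 30 * q\<^sup>2 \<le> real k" "real k \<le> 2 ^ 30 * q\<^sup>2 + 1"
  proof -
    have "0 \<le> 2 ^ 30 * q\<^sup>2" by simp
    then have "real k = of_int \<lceil>2 ^ 30 * q\<^sup>2\<rceil>" by (simp add: k_def)
    then show "2 ^ 30 * q\<^sup>2 \<le> real k" "real k \<le> 2 ^ 30 * q\<^sup>2 + 1" by linarith+
  qed
  then have k': "real k \<le> 2 ^ 31 * q\<^sup>2" using q2 by simp
  have eq: "\<epsilon>\<^sup>2 * q\<^sup>2 = L\<^sup>2" using assms(1) by (simp add: q_def power_divide)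
  have ek: "2 ^ 30 * L\<^sup>2 \<le> \<epsilon>\<^sup>2 * real k"
  proof -
    have "2 ^ 30 * L\<^sup>2 = \<epsilon>\<^sup>2 * (2 ^ 30 * q\<^sup>2)" unfolding eq[symmetric] by (simp only: mult_ac)
    also have "\<dots> \<le> \<epsilon>\<^sup>2 * real k" using k by (intro mult_left_mono) auto
    finally show ?thesis .
  qed
  have L2: "2 / 3 * L \<le> L\<^sup>2" using L by (simp add: power2_eq_square)
  show "10 ^ 8 \<le> \<epsilon>\<^sup>2 * real k" using ek L2 L by simp
  have "0 < 2 ^ 30 * q\<^sup>2" using q by simp
  then have kpos: "0 < real k" using k(1) by (rule less_le_trans)
  have "ln (7 * real k) \<le> ln (2 ^ 34 * q\<^sup>2)"
    using kpos k' q by (subst ln_le_cancel_iff) auto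
  also have "\<dots> = 34 * ln 2 + 2 * ln q"
  proof -
    have "ln (2 ^ 34 * q\<^sup>2) = ln (2 ^ 34) + ln (q\<^sup>2)" using q by (intro ln_mult_pos) auto
    moreover have "ln (2 ^ 34 :: real) = 34 * ln 2" using ln_realpow[of 2 34] by simp
    moreover have "ln (q\<^sup>2) = 2 * ln q" using ln_realpow[of q 2] q by simp
    ultimately show ?thesis by linarith
  qed
  also have "ln q = ln L + L"
  proof -
    have "ln q = ln L - ln \<epsilon>" unfolding q_def using L assms(1) by (intro ln_divide_pos) auto
    then show ?thesis using assms(1) by (simp add: L_def ln_div)
  qed
  also have "34 * ln 2 + 2 * (ln L + L) \<le> 34 + 4 * L"
    using ln2_le_25_over_36 ln_le_minus_one[of L] L by simp
  finally have "ln (7 * real k) \<le> 34 + 4 * L" .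
  then have "2 ^ 21 * (ln (7 * real k) + 5) \<le> 2 ^ 30 * L\<^sup>2" using L2 L by simp
  then show "2 ^ 21 * (ln (7 * real k) + 5) \<le> \<epsilon>\<^sup>2 * real k" using ek by linarith
  \<comment> \<open>Rounding up costs a factor 2 and the second half of the columns another, which
    turns \<open>2^30\<close> into \<open>2^32\<close>.\<close>
  have "real (2 * k) \<le> 2 ^ 32 * q\<^sup>2" using k' by simp
  then show "real (2 * k) \<le> 2 ^ 32 * (1 / \<epsilon>\<^sup>2) * (ln (1 / \<epsilon>))\<^sup>2"
    by (simp add: q_def L_def power_divide)
qed

section \<open>The sketch distribution and the tester on matrices\<close>

definition sketch_mat :: "nat \<Rightarrow> nat \<Rightarrow> (nat \<Rightarrow> nat \<Rightarrow> real) \<Rightarrow> real mat" where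
  "sketch_mat d k w = mat d k (\<lambda>(i, a). w a i)"

definition sketch_distr :: "nat \<Rightarrow> nat \<Rightarrow> real mat measure" where
  "sketch_distr d k = distr (measure_pmf (pmf_of_set (sign_cols {..<k} {..<d}))) (borel_mat d k) (sketch_mat d k)"

definition tester :: "nat \<Rightarrow> real \<Rightarrow> real mat \<Rightarrow> bool measure" where
  "tester k \<epsilon> X = return (count_space UNIV) (accepts k \<epsilon> (mfun X))"

lemma sketch_mat_carrier [simp]: "sketch_mat d k w \<in> carrier_mat d k"
  by (simp add: sketch_mat_def)

lemma sketch_mat_measurable: "sketch_mat d k \<in> measure_pmf p \<rightarrow>\<^sub>M borel_mat d k"
  by simp

lemma prob_space_sketch_distr: "prob_space (sketch_distr d k)"
  unfolding sketch_distr_def by (rule measure_pmf.prob_space_distr[OF sketch_mat_measurable])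

lemma sets_sketch_distr [simp]: "sets (sketch_distr d k) = sets (borel_mat d k)"
  by (simp add: sketch_distr_def)

lemma accepts_measurable:
  "Measurable.pred (borel_mat (2 * k) (2 * k)) (\<lambda>X. accepts k \<epsilon> (mfun X))"
  unfolding accepts_def
proof (rule pred_intros_finite(3)[OF finite_grid])
  fix y :: "nat \<Rightarrow> real"
  show "Measurable.pred (borel_mat (2 * k) (2 * k)) (\<lambda>X. (\<Sum>a<k. \<Sum>b<k. y a * y b * X $$ (a, b)) - (\<Sum>a<k. X $$ (a, a)) / real k * (\<Sum>a<k. (y a)\<^sup>2)
       \<ge> - (\<epsilon> / 16) * sqrt (\<Sum>a<k. \<Sum>b=k..<2 * k. (X $$ (a, b))\<^sup>2))"
    unfolding pred_def
    by (intro borel_measurable_le borel_measurable_diff borel_measurable_times borel_measurable_sum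
      borel_measurable_divide borel_measurable_const borel_measurable_power
      measurable_compose[OF _ borel_measurable_sqrt] measurable_entry) auto
qed

lemma tester_decision_procedure: "tester k \<epsilon> \<in> decision_procedures (2 * k)"
  unfolding decision_procedures_def tester_def
  by (rule measurable_compose[OF accepts_measurable measurable_return_prob_space])

lemma bilinear_sketch_entry:
  assumes "A \<in> carrier_mat d d" "a < k" "b < k"
  shows "bilinear_sketch A (sketch_mat d k w) $$ (a, b) = bf {..<d} (mfun A) (w a) (w b)"
proof -
  have "bilinear_sketch A (sketch_mat d k w) $$ (a, b) =
      (\<Sum>j<d. (\<Sum>i<d. w a i * A $$ (i, j)) * w b j)"
    using assms by (simp add: bilinear_sketch_def sketch_mat_def scalar_prod_def lessThan_atLeast0)
  also have "\<dots> = (\<Sum>i<d. \<Sum>j<d. w a i * A $$ (i, j) * w b j)"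
    unfolding sum_distrib_right by (rule sum.swap)
  also have "\<dots> = bf {..<d} (mfun A) (w a) (w b)"
    unfolding bf_def by (intro sum.cong refl) (simp only: mult_ac)
  finally show ?thesis .
qed

lemma accepts_cong:
  assumes "\<And>a b. a < 2 * k \<Longrightarrow> b < 2 * k \<Longrightarrow> X a b = Y a b"
  shows "accepts k \<epsilon> X = accepts k \<epsilon> Y"
proof -
  have "(\<Sum>a<k. \<Sum>b<k. y a * y b * X a b) = (\<Sum>a<k. \<Sum>b<k. y a * y b * Y a b)" for y :: "nat \<Rightarrow> real"
    using assms by (intro sum.cong refl) auto
  moreover have "(\<Sum>a<k. X a a) = (\<Sum>a<k. Y a a)"
    using assms by (intro sum.cong refl) auto
  moreover have "(\<Sum>a<k. \<Sum>b=k..<2 * k. (X a b)\<^sup>2) = (\<Sum>a<k. \<Sum>b=k..<2 * k. (Y a b)\<^sup>2)"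
    using assms by (intro sum.cong refl) auto
  ultimately show ?thesis by (simp add: accepts_def)
qed

text \<open>The tester is a point mass and the columns are uniform on a finite set, so the output
  probability of the kernel formulation is the proportion of sign patterns with that
  verdict.\<close>

lemma prob_output_tester:
  assumes A: "A \<in> carrier_mat d d"
  shows "prob_output (sketch_distr d (2 * k)) (tester k \<epsilon>) A b =
    avg (sign_cols {..<2 * k} {..<d}) (\<lambda>w. of_bool (accepts k \<epsilon> (\<lambda>a b. bf {..<d} (mfun A) (w a) (w b)) = b))"
proof -
  let ?f = "\<lambda>G. measure (tester k \<epsilon> (bilinear_sketch A G)) {b}"
  have f: "?f G = indicator {b} (accepts k \<epsilon> (mfun (bilinear_sketch A G)))" for G
    by (simp add: tester_def measure_return)
  have meas: "?f \<in> borel_measurable (borel_mat d (2 * k))"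
    unfolding f
    by (rule measurable_compose[OF measurable_compose[OF measurable_bilinear_sketch[OF A] accepts_measurable]]) simp
  have "prob_output (sketch_distr d (2 * k)) (tester k \<epsilon>) A b = (\<integral>G. ?f G \<partial>sketch_distr d (2 * k))"
    by (rule prob_output_eq_integral[OF prob_space_sketch_distr sets_sketch_distr tester_decision_procedure A])
  also have "\<dots> = measure_pmf.expectation (pmf_of_set (sign_cols {..<2 * k} {..<d})) (\<lambda>w. ?f (sketch_mat d (2 * k) w))"
    unfolding sketch_distr_def by (rule integral_distr[OF sketch_mat_measurable meas])
  also have "\<dots> = avg (sign_cols {..<2 * k} {..<d}) (\<lambda>w. ?f (sketch_mat d (2 * k) w))"
    unfolding avg_def by (rule integral_pmf_of_set) simp_all
  also have "\<dots> = avg (sign_cols {..<2 * k} {..<d}) (\<lambda>w. of_bool (accepts k \<epsilon> (\<lambda>a b. bf {..<d} (mfun A) (w a) (w b)) = b))"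
  proof (rule avg_cong)
    fix w
    have "accepts k \<epsilon> (mfun (bilinear_sketch A (sketch_mat d (2 * k) w))) =
        accepts k \<epsilon> (\<lambda>a b. bf {..<d} (mfun A) (w a) (w b))"
      by (rule accepts_cong) (rule bilinear_sketch_entry[OF A])
    then show "?f (sketch_mat d (2 * k) w) = of_bool (accepts k \<epsilon> (\<lambda>a b. bf {..<d} (mfun A) (w a) (w b)) = b)"
      by (simp add: f indicator_def)
  qed
  finally show ?thesis .
qed

theorem theorem28:
  shows "\<exists>C::real. C > 0 \<and>
    (\<forall>d::nat. \<forall>\<epsilon>::real. d \<ge> 1 \<longrightarrow> 0 < \<epsilon> \<longrightarrow> \<epsilon> \<le> 1 / 2 \<longrightarrow>
      (\<exists>k::nat. real k \<le> C * (1 / \<epsilon>\<^sup>2) * (ln (1 / \<epsilon>))\<^sup>2 \<and>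
        (\<exists>M. prob_space M \<and> sets M = sets (borel_mat d k) \<and>
          (\<exists>D \<in> decision_procedures k.
            \<forall>A \<in> carrier_mat d d. symmetric_mat A \<longrightarrow>
              (psd_mat A \<longrightarrow> prob_output M D A True \<ge> 9 / 10) \<and>
              (A \<noteq> 0\<^sub>m d d \<and> lambda_min A \<le> - \<epsilon> * frobenius_norm A \<longrightarrow>
                 prob_output M D A False \<ge> 9 / 10)))))"
proof (rule exI[of _ "2 ^ 32"], intro conjI allI impI)
  show "0 < (2 ^ 32 :: real)" by simp
  fix d :: nat and \<epsilon> :: real
  assume d: "d \<ge> 1" and eps: "0 < \<epsilon>" "\<epsilon> \<le> 1 / 2"
  obtain k :: nat where k: "10 ^ 8 \<le> \<epsilon>\<^sup>2 * real k" "2 ^ 21 * (ln (7 * real k) + 5) \<le> \<epsilon>\<^sup>2 * real k"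
    "real (2 * k) \<le> 2 ^ 32 * (1 / \<epsilon>\<^sup>2) * (ln (1 / \<epsilon>))\<^sup>2"
    using choose_dimension[OF eps] by blast
  have sketch: "sketch {..<d} (mfun A) k \<epsilon> (frobenius_norm A)"
    if A: "A \<in> carrier_mat d d" "symmetric_mat A" "A \<noteq> 0\<^sub>m d d" for A
  proof
    show "(frobenius_norm A)\<^sup>2 = frob2 {..<d} (mfun A)" by (rule frobenius_norm_sq[OF A(1)])
    obtain i j where ij: "i < d" "j < d" "A $$ (i, j) \<noteq> 0"
      using A(1,3) by (metis carrier_matD eq_matI index_zero_mat)
    have "0 < (A $$ (i, j))\<^sup>2" using ij by simp
    also have "\<dots> \<le> (\<Sum>j<d. (A $$ (i, j))\<^sup>2)"
      using ij by (intro member_le_sum[of j "{..<d}" "\<lambda>j. (A $$ (i, j))\<^sup>2"]) auto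
    also have "\<dots> \<le> (\<Sum>i<d. \<Sum>j<d. (A $$ (i, j))\<^sup>2)"
      using ij by (intro member_le_sum[of i "{..<d}" "\<lambda>i. \<Sum>j<d. (A $$ (i, j))\<^sup>2"]) (auto intro: sum_nonneg)
    finally show "0 < frobenius_norm A" using A(1) by (simp add: frobenius_norm_def)
  qed (use A k eps symmetric_on_mfun in auto)
  show "\<exists>k::nat. real k \<le> 2 ^ 32 * (1 / \<epsilon>\<^sup>2) * (ln (1 / \<epsilon>))\<^sup>2 \<and>
        (\<exists>M. prob_space M \<and> sets M = sets (borel_mat d k) \<and>
          (\<exists>D \<in> decision_procedures k.
            \<forall>A \<in> carrier_mat d d. symmetric_mat A \<longrightarrow>
              (psd_mat A \<longrightarrow> prob_output M D A True \<ge> 9 / 10) \<and>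
              (A \<noteq> 0\<^sub>m d d \<and> lambda_min A \<le> - \<epsilon> * frobenius_norm A \<longrightarrow>
                 prob_output M D A False \<ge> 9 / 10)))"
  proof (intro exI[of _ "2 * k"] conjI exI[of _ "sketch_distr d (2 * k)"]
      bexI[OF _ tester_decision_procedure[of k \<epsilon>]] ballI impI)
    fix A assume A: "A \<in> carrier_mat d d" "symmetric_mat A"
    {
      assume psd: "psd_mat A"
      show "9 / 10 \<le> prob_output (sketch_distr d (2 * k)) (tester k \<epsilon>) A True"
      proof (cases "A = 0\<^sub>m d d")
        \<comment> \<open>The zero matrix lies outside the locale, which needs \<open>F > 0\<close>.
          All entries vanish and the test reads \<open>0 \<ge> 0\<close>, which passes because the
          inequality is not strict.\<close>
        case True
        then have "bf {..<d} (mfun A) x y = 0" for x y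
          by (auto simp: bf_def intro!: sum.neutral)
        then show ?thesis
          unfolding prob_output_tester[OF A(1)] by (simp add: accepts_def avg_const)
      next
        case False
        interpret sketch "{..<d}" "mfun A" k \<epsilon> "frobenius_norm A" by (rule sketch[OF A False])
        show ?thesis
          using avg_psd_accepts[OF psd_on_mfun[OF A(1) psd]] by (simp add: prob_output_tester[OF A(1)])
      qed
    }
    {
      assume far: "A \<noteq> 0\<^sub>m d d \<and> lambda_min A \<le> - \<epsilon> * frobenius_norm A"
      interpret sketch "{..<d}" "mfun A" k \<epsilon> "frobenius_norm A" by (rule sketch[OF A]) (use far in blast)
      obtain u where "ip {..<d} u u = 1" "\<And>i. i < d \<Longrightarrow> mv {..<d} (mfun A) u i = lambda_min A * u i"
        using lambda_min_eigenvector[OF A(1) _ A(2)] d by auto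
      then show "9 / 10 \<le> prob_output (sketch_distr d (2 * k)) (tester k \<epsilon>) A False"
        using avg_far_rejects[of u "lambda_min A"] far by (simp add: prob_output_tester[OF A(1)])
    }
  qed (use k(3) prob_space_sketch_distr in auto)
qed

end
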